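(* Let $n$ be a non-negative integer and let $\alpha,\beta,\gamma$ be non-negative integers with $\alpha+\beta+\gamma=n+2$. Let $P_{n+2}^{\to}$ be a convex polygon with $n+2$ vertices together with a marked oriented boundary edge $\vec e$. For a triangulation $\tau$ of $P_{n+2}^{\to}$ (using only the vertices of the polygon), consider the unique colouring of the $n+2$ vertices by the three colours $\mathtt a,\mathtt b,\mathtt c$ such that the starting vertex of $\vec e$ has colour $\mathtt b$, the ending vertex of $\vec e$ has colour $\mathtt c$, and the three vertices of every triangle of $\tau$ have pairwise different colours. Then the number of triangulations of $P_{n+2}^{\to}$ for which this colouring has exactly $\alpha$ vertices of colour $\mathtt a$, $\beta$ vertices of colour $\mathtt b$ and $\gamma$ vertices of colour $\mathtt c$ equals $$\frac{\alpha(\alpha+\beta+\gamma-2)}{(\beta+\gamma-1)(\alpha+\gamma-1)(\alpha+\beta-1)}\binom{\beta+\gamma-1}{\alpha}\binom{\alpha+\gamma-1}{\beta-1}\binom{\alpha+\beta-1}{\gamma-1}.$$ In the case $\alpha=0$ this expression is to be interpreted as its limit as $\alpha\to0$, i.e. the number is $1$ if $(\alpha,\beta,\gamma)=(0,1,1)$ and $0$ otherwise.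
   Context: A convex polygon means one all of whose angles are less than 180 degrees; only the combinatorics matters, so for each $n$ one fixed polygon $P_{n+2}$ is considered, and $P_{n+2}^{\to}$ denotes it with a marked oriented boundary edge (the root edge). A triangulation of $P_{n+2}$ has exactly $n$ triangles. In the degenerate case $n=0$, the "polygon" $P_2^{\to}$ consists only of the marked oriented edge, and by convention there is exactly one triangulation (with no triangles), its two vertices coloured $\mathtt b$ (start) and $\mathtt c$ (end). For every triangulation the colouring described in the claim exists and is unique. *)

theory Defs
  imports Complex_Main "HOL-Library.FuncSet"
begin

text \<open>The convex polygon with \<open>n + 2\<close> vertices is represented combinatorially: its vertices
  are \<open>0, \<dots>, n + 1\<close>, numbered in cyclic order along the boundary, and the segment between two
  vertices is the set of its two end points. For \<open>n = 0\<close> the only segment is \<open>{0, 1}\<close>, which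
  is a side.\<close>

definition vertices :: "nat \<Rightarrow> nat set" where
  "vertices n = {..<n + 2}"

definition sides :: "nat \<Rightarrow> nat set set" where
  "sides n = (\<lambda>i. {i, Suc i mod (n + 2)}) ` vertices n"

definition diagonals :: "nat \<Rightarrow> nat set set" where
  "diagonals n = {d. d \<subseteq> vertices n \<and> card d = 2 \<and> d \<notin> sides n}"

text \<open>Two diagonals meet in their relative interiors iff their end points alternate around the
  polygon.\<close>

definition crossing :: "nat set \<Rightarrow> nat set \<Rightarrow> bool" where
  "crossing d d' \<longleftrightarrow>
     (\<exists>i k j l. i < k \<and> k < j \<and> j < l \<and>
        (d = {i, j} \<and> d' = {k, l} \<or> d = {k, l} \<and> d' = {i, j}))"

definition noncrossing :: "nat set set \<Rightarrow> bool" where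
  "noncrossing D \<longleftrightarrow> (\<forall>d\<in>D. \<forall>d'\<in>D. \<not> crossing d d')"

text \<open>A triangulation using only the vertices of the polygon is a maximal set of pairwise
  noncrossing diagonals. For \<open>n = 0\<close> and \<open>n = 1\<close> there are no diagonals, and the empty set is
  the unique triangulation.\<close>

definition triangulations :: "nat \<Rightarrow> nat set set set" where
  "triangulations n =
     {D. D \<subseteq> diagonals n \<and> noncrossing D \<and>
         (\<forall>D'. D \<subseteq> D' \<and> D' \<subseteq> diagonals n \<and> noncrossing D' \<longrightarrow> D' = D)}"

text \<open>Since the vertices are in convex position, three vertices that are pairwise joined by sides
  or diagonals of a triangulation always span one of its triangles.\<close>

definition triangles :: "nat \<Rightarrow> nat set set \<Rightarrow> nat set set" where
  "triangles n D =
     {T. T \<subseteq> vertices n \<and> card T = 3 \<and>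
         (\<forall>x\<in>T. \<forall>y\<in>T. x \<noteq> y \<longrightarrow> {x, y} \<in> sides n \<union> D)}"

datatype colour = Col_a | Col_b | Col_c

text \<open>Colourings are taken to be extensional functions on the vertices, so that a colouring is
  determined by the colours of the vertices and can be unique. The root edge is directed from
  \<open>s\<close> to \<open>e\<close>.\<close>

definition is_colouring :: "nat \<Rightarrow> nat \<Rightarrow> nat \<Rightarrow> nat set set \<Rightarrow> (nat \<Rightarrow> colour) \<Rightarrow> bool" where
  "is_colouring n s e D c \<longleftrightarrow>
     c \<in> vertices n \<rightarrow>\<^sub>E UNIV \<and> c s = Col_b \<and> c e = Col_c \<and>
     (\<forall>T\<in>triangles n D. inj_on c T)"

definition colouring :: "nat \<Rightarrow> nat \<Rightarrow> nat \<Rightarrow> nat set set \<Rightarrow> nat \<Rightarrow> colour" where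
  "colouring n s e D = (THE c. is_colouring n s e D c)"

definition num_coloured :: "nat \<Rightarrow> (nat \<Rightarrow> colour) \<Rightarrow> colour \<Rightarrow> nat" where
  "num_coloured n c x = card {v \<in> vertices n. c v = x}"

text \<open>Binomial coefficients with integer arguments, vanishing for a negative lower index. A
  version on natural numbers would be wrong here: truncated subtraction turns the lower
  index \<open>- 1\<close> into \<open>0\<close>. With \<open>\<alpha> \<ge> 1\<close>, a denominator of the counting formula
  can vanish only if \<open>\<beta> = 0\<close> or \<open>\<gamma> = 0\<close>, where the numerator has a factor \<open>binom _ (- 1)\<close>
  and the expression is read as \<open>0\<close>.\<close>

definition binom :: "int \<Rightarrow> int \<Rightarrow> real" where
  "binom m k = (if k < 0 then 0 else of_int m gchoose nat k)"

end

theory Submission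
  imports Defs
begin

text \<open>Cutting along the triangle at the root edge turns triangulations into binary trees. If
  \<open>X\<^sub>a\<close> is the generating function for a root edge with ends coloured \<open>b\<close>, \<open>c\<close>, and
  similarly \<open>X\<^sub>b\<close>, \<open>X\<^sub>c\<close>, then \<open>X\<^sub>a = 1 + a X\<^sub>b X\<^sub>c\<close> and cyclically. Multiplied by an arbitrary
  monomial in the \<open>X\<close>'s, this is a linear recurrence for the numbers of forests. These numbers
  are predicted by Good's multivariate Lagrange inversion, and with the prediction in the right
  variables the recurrence is just Pascal's rule. Reflections of the polygon carry any root
  edge to \<open>(0, n + 1)\<close>.\<close>

text \<open>No power series occur: inversion only supplies a guess, and the recurrence together with
  the value at the empty forest determines all forest numbers. Pascal's rule would hold with any
  fixed series in place of the determinant; the determinant is what makes the empty forest come out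
  as 1 without vertices and 0 otherwise. For positive exponents this is the identity (j+k)(i+k)(i+j)
  = ij(i+j) + ik(i+k) + jk(j+k) + 2ijk. A root edge coloured b, c raises the first exponent by one,
  which changes the vanishing numerator by (i+k)(i+j) - jk = i(i+j+k); with i = \<alpha>, j =
  \<beta> - 1, k = \<gamma> - 1 this is the factor \<alpha>(\<alpha>+\<beta>+\<gamma>-2) of the
  theorem. On the geometric side only maximal sets of diagonals are given, so the triangle at the
  root edge must be extracted from maximality. Maximality is therefore put in a pointwise form that
  passes to the two intervals beside the apex.\<close>

section \<open>The Lagrange-Good coefficients and the enumeration of forests\<close>

text \<open>The coefficient of \<open>u\<^sup>i\<close> in \<open>u (1 + u)\<^bsup>A - 1\<^esup>\<close>; for \<open>A = 0\<close> the exponent is \<open>- 1\<close>, hence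
  the generalized binomial coefficient.\<close>

definition shifted_binomial :: "nat \<Rightarrow> nat \<Rightarrow> real" where
  "shifted_binomial A i = (if i = 0 then 0 else (real A - 1) gchoose (i - 1))"

text \<open>The coefficient of \<open>u\<^sup>i v\<^sup>j w\<^sup>k\<close> in
  \<open>(1 + u)\<^sup>A (1 + v)\<^sup>B (1 + w)\<^sup>C (1 - PQ - PR - QR - 2PQR)\<close> with \<open>P = u / (1 + u)\<close>,
  \<open>Q = v / (1 + v)\<close>, \<open>R = w / (1 + w)\<close>; the last factor is the determinant in Good's formula.\<close>

definition good_coeff :: "nat \<Rightarrow> nat \<Rightarrow> nat \<Rightarrow> nat \<Rightarrow> nat \<Rightarrow> nat \<Rightarrow> real" where
  "good_coeff A B C i j k =
     (real A gchoose i) * (real B gchoose j) * (real C gchoose k)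
     - shifted_binomial A i * shifted_binomial B j * (real C gchoose k)
     - shifted_binomial A i * (real B gchoose j) * shifted_binomial C k
     - (real A gchoose i) * shifted_binomial B j * shifted_binomial C k
     - 2 * shifted_binomial A i * shifted_binomial B j * shifted_binomial C k"

lemma gbinomial_pascal:
  "real (Suc A) gchoose i = (real A gchoose i) + (if i = 0 then 0 else real A gchoose (i - 1))"
  using gbinomial_Suc_Suc[of "real A"] by (cases i) (auto simp: add.commute)

text \<open>Multiplication of u (1 + u)^(A - 1) by 1 + u. At A = 0 it depends on the upper entry
  being the real number -1; truncation to 0 would break it at i = 2.\<close>

lemma shifted_binomial_pascal:
  "shifted_binomial (Suc A) i =
     shifted_binomial A i + (if i = 0 then 0 else shifted_binomial A (i - 1))"
proof (cases "i \<ge> 2")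
  case True
  then obtain m where "i = Suc (Suc m)"
    by (metis add_2_eq_Suc le_Suc_ex)
  then show ?thesis
    using gbinomial_Suc_Suc[of "real A - 1" m] by (simp add: shifted_binomial_def)
next
  case False
  then have "i = 0 \<or> i = 1" by auto
  then show ?thesis by (auto simp: shifted_binomial_def)
qed

lemma good_coeff_pascal1:
  "good_coeff (Suc A) B C i j k =
     good_coeff A B C i j k + (if i = 0 then 0 else good_coeff A B C (i - 1) j k)"
  unfolding good_coeff_def gbinomial_pascal[of A i] shifted_binomial_pascal[of A i]
  by (auto simp: algebra_simps)

text \<open>The determinant is invariant under cyclic shifts of the variables, which carries
  Pascal's rule from the first variable to the other two.\<close>

lemma good_coeff_rotate: "good_coeff A B C i j k = good_coeff B C A j k i"
  unfolding good_coeff_def by (simp add: algebra_simps)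

lemma good_coeff_pascal2:
  "good_coeff A (Suc B) C i j k =
     good_coeff A B C i j k + (if j = 0 then 0 else good_coeff A B C i (j - 1) k)"
  using good_coeff_pascal1[of B C A j k i] by (simp only: good_coeff_rotate[of A])

lemma good_coeff_pascal3:
  "good_coeff A B (Suc C) i j k =
     good_coeff A B C i j k + (if k = 0 then 0 else good_coeff A B C i j (k - 1))"
  using good_coeff_pascal1[of C A B k i j] by (simp only: good_coeff_rotate[of A] good_coeff_rotate[of B])

lemma shifted_binomial_absorb:
  assumes "A > 0"
  shows "shifted_binomial A i = real i / real A * (real A gchoose i)"
proof (cases i)
  case (Suc m)
  have "real (Suc m) * (real A gchoose Suc m) = real A * ((real A - 1) gchoose m)"
    by (rule gbinomial_absorption)
  then show ?thesis
    using assms Suc by (simp add: shifted_binomial_def field_simps)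
qed (simp add: shifted_binomial_def)

text \<open>By absorption each factor u / (1 + u) of the determinant acts as the number i / A, so
  the determinant becomes a scalar in front of the product of binomial coefficients.\<close>

lemma good_coeff_eq:
  assumes "A > 0" "B > 0" "C > 0"
  shows "good_coeff A B C i j k =
    (real A * real B * real C - real i * real j * real C - real i * real k * real B
      - real j * real k * real A - 2 * real i * real j * real k)
    / (real A * real B * real C)
    * (real A gchoose i) * (real B gchoose j) * (real C gchoose k)"
  unfolding good_coeff_def shifted_binomial_absorb[OF assms(1)]
    shifted_binomial_absorb[OF assms(2)] shifted_binomial_absorb[OF assms(3)]
  using assms by (simp add: field_simps)

lemma gbinomial_0_left_pos: "i > 0 \<Longrightarrow> (0::real) gchoose i = 0"
  by (metis binomial_eq_0_iff binomial_gbinomial of_nat_0)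

lemma good_coeff_base_axis: "i > 0 \<Longrightarrow> good_coeff 0 i i i 0 0 = 0"
  by (simp add: good_coeff_def shifted_binomial_def gbinomial_0_left_pos)

text \<open>The predicted number for the empty forest. If an exponent such as j + k is 0, where
  \<open>good_coeff_eq\<close> cannot divide, then only i can be nonzero and the value is read off
  the definition.\<close>

lemma good_coeff_base:
  "good_coeff (j + k) (i + k) (i + j) i j k = (if i = 0 \<and> j = 0 \<and> k = 0 then 1 else 0)"
proof (cases "j + k > 0 \<and> i + k > 0 \<and> i + j > 0")
  case True
  then have pos: "j + k > 0" "i + k > 0" "i + j > 0" by auto
  show ?thesis
    unfolding good_coeff_eq[OF pos] using True by (auto simp: field_simps)
next
  case False
  then consider "i = 0" "j = 0" "k = 0" | "i > 0" "j = 0" "k = 0"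
    | "i = 0" "j > 0" "k = 0" | "i = 0" "j = 0" "k > 0"
    by (cases i; cases j; cases k) auto
  then show ?thesis
  proof cases
    case 1
    then show ?thesis by (simp add: good_coeff_def shifted_binomial_def)
  next
    case 2
    then show ?thesis using good_coeff_base_axis[of i] by simp
  next
    case 3
    then show ?thesis using good_coeff_base_axis[of j] good_coeff_rotate[of j 0 j 0 j 0] by simp
  next
    case 4
    then show ?thesis
      using good_coeff_base_axis[of k] good_coeff_rotate[of 0 k k k 0 0] good_coeff_rotate[of k k 0 0 0 k]
      by simp
  qed
qed

lemma good_coeff_closed_form:
  "good_coeff (Suc (j + k)) (i + k) (i + j) i j k =
    (if i = 0 then (if j = 0 \<and> k = 0 then 1 else 0)
     else real i * real (i + j + k) / (real (j + k + 1) * real (i + k) * real (i + j))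
       * (real (j + k + 1) gchoose i) * (real (i + k) gchoose j) * (real (i + j) gchoose k))"
proof (cases "i = 0")
  \<comment> \<open>For i = 0 the exponents i + k and i + j may vanish. Pascal's rule in the first
    variable then has a single summand, the value for the empty forest.\<close>
  case True
  then show ?thesis
    using good_coeff_base[of j k 0] by (simp add: good_coeff_pascal1)
next
  case False
  then have pos: "Suc (j + k) > 0" "i + k > 0" "i + j > 0" by auto
  \<comment> \<open>All terms cancel as for the empty forest, except those created by the extra 1 in
    the first exponent.\<close>
  have num: "real (Suc (j + k)) * real (i + k) * real (i + j) - real i * real j * real (i + j)
       - real i * real k * real (i + k) - real j * real k * real (Suc (j + k))
       - 2 * real i * real j * real k = real i * real (i + j + k)"
    by (simp add: algebra_simps)
  show ?thesis
    unfolding good_coeff_eq[OF pos] num using False by simp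
qed

section \<open>Coloured binary trees and forests\<close>

datatype bintree = Leaf | Node bintree bintree

primrec leaves :: "bintree \<Rightarrow> nat" where
  "leaves Leaf = 1"
| "leaves (Node l r) = leaves l + leaves r"

lemma leaves_pos [simp]: "leaves t > 0"
  by (induction t) auto

lemma leaves_neq_0 [simp]: "leaves t \<noteq> 0"
  using leaves_pos[of t] by (metis less_irrefl)

definition third :: "colour \<Rightarrow> colour \<Rightarrow> colour" where
  "third x y = (if Col_a \<notin> {x, y} then Col_a else if Col_b \<notin> {x, y} then Col_b else Col_c)"

lemma third_simps:
  assumes "x \<noteq> y"
  shows "third x y \<noteq> x" "third x y \<noteq> y" "x \<noteq> third x y" "y \<noteq> third x y"
    "third x (third x y) = y" "third (third x y) y = x"
  using assms by (cases x; cases y; simp add: third_def)+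

lemma third_unique: "x \<noteq> y \<Longrightarrow> z \<noteq> x \<Longrightarrow> z \<noteq> y \<Longrightarrow> z = third x y"
  by (cases x; cases y; cases z; simp add: third_def)

text \<open>The colours of the vertices strictly between the ends of the root edge, in boundary order,
  where \<open>x\<close> and \<open>y\<close> are the colours of the first and the last vertex.\<close>

primrec inner_colours :: "colour \<Rightarrow> colour \<Rightarrow> bintree \<Rightarrow> colour list" where
  "inner_colours x y Leaf = []"
| "inner_colours x y (Node l r) =
     inner_colours x (third x y) l @ third x y # inner_colours (third x y) y r"

lemma length_inner_colours: "length (inner_colours x y t) = leaves t - 1"
proof (induction t arbitrary: x y)
  case (Node l r)
  then show ?case
    using leaves_pos[of l] leaves_pos[of r] by (simp del: leaves_pos leaves_neq_0)
qed simp

fun forest_colours :: "(colour \<times> colour) list \<Rightarrow> bintree list \<Rightarrow> colour list" where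
  "forest_colours ((x, y) # L) (t # ts) = inner_colours x y t @ forest_colours L ts"
| "forest_colours _ _ = []"

text \<open>Counting these gives the coefficient of the monomial with exponents \<open>f\<close> in
  the product of the series \<open>X\<^sub>w\<close>, w = \<open>third x y\<close>, over the entries
  (x, y) of \<open>L\<close>; \<open>root_count L w\<close> is the exponent of
  \<open>X\<^sub>w\<close>.\<close>

definition forests :: "(colour \<times> colour) list \<Rightarrow> (colour \<Rightarrow> nat) \<Rightarrow> bintree list set" where
  "forests L f = {ts. length ts = length L \<and> (\<forall>w. count_list (forest_colours L ts) w = f w)}"

definition root_count :: "(colour \<times> colour) list \<Rightarrow> colour \<Rightarrow> nat" where
  "root_count L w = length (filter (\<lambda>(x, y). third x y = w) L)"

text \<open>With \<open>X\<^sub>a\<close> = 1 + u and so on, the system reads u = a (1 + v)(1 + w)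
  and cyclically. Each vertex of colour a thus contributes (1 + v)(1 + w) to Good's formula, and
  each root edge of type a contributes 1 + u; the upper arguments collect these exponents.\<close>

definition forest_number :: "(colour \<times> colour) list \<Rightarrow> (colour \<Rightarrow> nat) \<Rightarrow> real" where
  "forest_number L f =
     good_coeff (root_count L Col_a + (f Col_b + f Col_c)) (root_count L Col_b + (f Col_a + f Col_c))
       (root_count L Col_c + (f Col_a + f Col_b)) (f Col_a) (f Col_b) (f Col_c)"

text \<open>Undoes the removal of the root triangle of the first tree of a forest.\<close>

fun join_first :: "bintree list \<Rightarrow> bintree list" where
  "join_first (l # r # ts) = Node l r # ts"
| "join_first ts = ts"

text \<open>Shorter lists are fixed by \<open>join_first\<close> and would collide:
  \<open>[Node l r]\<close> is also the image of \<open>[l, r]\<close>.\<close>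

lemma inj_on_join_first: "inj_on join_first {ts. length ts \<ge> 2}"
proof (rule inj_onI)
  fix us vs :: "bintree list"
  assume "us \<in> {ts. length ts \<ge> 2}" "vs \<in> {ts. length ts \<ge> 2}" "join_first us = join_first vs"
  then show "us = vs"
    by (cases us rule: join_first.cases; cases vs rule: join_first.cases) auto
qed

text \<open>Either the first tree is a leaf, or removing its root triangle deletes an apex of colour
  z and leaves trees at the edges (x, z) and (z, y). The guard keeps the truncated
  \<open>f z - 1\<close> from producing forests when \<open>f z = 0\<close>.\<close>

lemma forests_Cons:
  fixes x y :: colour and f :: "colour \<Rightarrow> nat"
  defines "z \<equiv> third x y"
  shows "forests ((x, y) # L) f = Cons Leaf ` forests L f \<union>
    (if f z = 0 then {} else join_first ` forests ((x, z) # (z, y) # L) (f(z := f z - 1)))"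
    (is "?L = ?A \<union> ?B")
proof (intro equalityI subsetI)
  fix us assume us: "us \<in> ?L"
  then obtain t ts where us_eq: "us = t # ts"
    by (cases us) (auto simp: forests_def)
  show "us \<in> ?A \<union> ?B"
  proof (cases t)
    case Leaf
    then show ?thesis using us us_eq by (auto simp: forests_def)
  next
    case (Node l r)
    have cnt: "count_list (forest_colours ((x, z) # (z, y) # L) (l # r # ts)) w
        + (if w = z then 1 else 0) = f w" for w
      using us us_eq Node by (auto simp: forests_def z_def split: if_splits)
    have "f z \<noteq> 0" using cnt[of z] by auto
    moreover have "l # r # ts \<in> forests ((x, z) # (z, y) # L) (f(z := f z - 1))"
      unfolding forests_def
    proof (intro CollectI conjI allI)
      show "length (l # r # ts) = length ((x, z) # (z, y) # L)"
        using us us_eq by (simp add: forests_def)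
      show "count_list (forest_colours ((x, z) # (z, y) # L) (l # r # ts)) w = (f(z := f z - 1)) w" for w
        using cnt[of w] by (auto split: if_splits)
    qed
    moreover have "us = join_first (l # r # ts)" using us_eq Node by simp
    ultimately have "us \<in> ?B" by (simp add: image_iff) (metis join_first.simps(1))
    then show ?thesis ..
  qed
next
  fix us assume us: "us \<in> ?A \<union> ?B"
  show "us \<in> ?L"
  proof (cases "us \<in> ?A")
    case True
    then show ?thesis by (auto simp: forests_def)
  next
    case False
    then have nz: "f z \<noteq> 0"
      and "us \<in> join_first ` forests ((x, z) # (z, y) # L) (f(z := f z - 1))"
      using us by (auto split: if_splits)
    then obtain vs where vs: "vs \<in> forests ((x, z) # (z, y) # L) (f(z := f z - 1))" "us = join_first vs"
      by blast
    then obtain l r ts where vs_eq: "vs = l # r # ts"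
      by (cases vs rule: join_first.cases) (auto simp: forests_def)
    have "length ts = length L"
      using vs vs_eq by (simp add: forests_def)
    moreover have "count_list (forest_colours ((x, y) # L) us) w = f w" for w
    proof -
      have "count_list (forest_colours ((x, z) # (z, y) # L) vs) w = (f(z := f z - 1)) w"
        using vs by (simp add: forests_def)
      then show ?thesis using vs(2) vs_eq nz by (auto simp: z_def split: if_splits)
    qed
    ultimately show ?thesis using vs(2) vs_eq by (auto simp: forests_def)
  qed
qed

text \<open>Opening a triangle adds one root edge of each of the types x and y and uses up a vertex
  of colour z. In the exponents for x and y the two changes cancel, while the exponent for z drops
  by one in both summands: Pascal's rule in that variable.\<close>

lemma forest_number_Cons:
  assumes "x \<noteq> y"
  defines "z \<equiv> third x y"
  shows "forest_number ((x, y) # L) f = forest_number L f +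
    (if f z = 0 then 0 else forest_number ((x, z) # (z, y) # L) (f(z := f z - 1)))"
proof -
  have rc: "root_count ((x, y) # L) w = root_count L w + (if w = z then 1 else 0)"
    "root_count ((x, z) # (z, y) # L) w = root_count L w + (if w = z then 0 else 1)" for w
    using assms(1) by (cases x; cases y; cases w; simp add: root_count_def third_def z_def)+
  have mv: "u \<noteq> 0 \<Longrightarrow> Suc (r + (u - Suc 0 + v)) = r + (u + v)" "u \<noteq> 0 \<Longrightarrow> Suc (r + (v + (u - Suc 0))) = r + (v + u)"
    for r u v :: nat by auto
  show ?thesis
    unfolding forest_number_def rc
    by (cases z) (simp_all add: good_coeff_pascal1 good_coeff_pascal2 good_coeff_pascal3 mv)
qed

lemma forest_number_Nil: "forest_number [] f = (if \<forall>w. f w = 0 then 1 else 0)"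
proof -
  have "(\<forall>w. f w = 0) \<longleftrightarrow> f Col_a = 0 \<and> f Col_b = 0 \<and> f Col_c = 0"
    by (metis colour.exhaust)
  then show ?thesis
    by (simp add: forest_number_def root_count_def good_coeff_base)
qed

lemma forests_Nil: "forests [] f = (if \<forall>w. f w = 0 then {[]} else {})"
  by (auto simp: forests_def)

lemma card_forests:
  assumes "\<forall>(x, y)\<in>set L. x \<noteq> y"
  shows "finite (forests L f) \<and> real (card (forests L f)) = forest_number L f"
  using assms
\<comment> \<open>Dropping a leaf shortens \<open>L\<close> by one; opening a node lengthens it by
  one but uses up a vertex. Weight 2 per vertex makes both steps decrease.\<close>
proof (induction "2 * (f Col_a + f Col_b + f Col_c) + length L" arbitrary: L f rule: less_induct)
  case less
  show ?case
  proof (cases L)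
    case Nil
    then show ?thesis by (simp add: forests_Nil forest_number_Nil)
  next
    case (Cons p L')
    then obtain x y where L: "L = (x, y) # L'" by (cases p) auto
    have xy: "x \<noteq> y" and L': "\<forall>(x, y)\<in>set L'. x \<noteq> y"
      using less.prems L by auto
    define z where "z = third x y"
    have IH1: "finite (forests L' f)" "real (card (forests L' f)) = forest_number L' f"
      using less.hyps[of f L'] L L' by auto
    let ?S = "forests ((x, z) # (z, y) # L') (f(z := f z - 1))"
    have IH2: "finite ?S \<and> real (card ?S) = forest_number ((x, z) # (z, y) # L') (f(z := f z - 1))"
      if "f z \<noteq> 0"
    proof (rule less.hyps)
      show "2 * ((f(z := f z - 1)) Col_a + (f(z := f z - 1)) Col_b + (f(z := f z - 1)) Col_c)
          + length ((x, z) # (z, y) # L') < 2 * (f Col_a + f Col_b + f Col_c) + length L"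
        using that L by (cases z) auto
      show "\<forall>(x, y)\<in>set ((x, z) # (z, y) # L'). x \<noteq> y"
        using L' third_simps[OF xy] by (auto simp: z_def)
    qed
    have inj2: "inj_on join_first ?S"
      by (rule inj_on_subset[OF inj_on_join_first]) (auto simp: forests_def)
    have disj: "Cons Leaf ` forests L' f \<inter> join_first ` ?S = {}"
    proof -
      have "\<forall>vs\<in>?S. \<exists>l r ts. join_first vs = Node l r # ts"
      proof
        fix vs assume "vs \<in> ?S"
        then show "\<exists>l r ts. join_first vs = Node l r # ts"
          by (cases vs rule: join_first.cases) (auto simp: forests_def)
      qed
      then show ?thesis by fastforce
    qed
    show ?thesis
    proof (cases "f z = 0")
      case True
      then show ?thesis
        unfolding L forests_Cons[of x y L' f] forest_number_Cons[OF xy, of L' f] z_def[symmetric]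
        using IH1 by (simp add: card_image)
    next
      case False
      then show ?thesis
        unfolding L forests_Cons[of x y L' f] forest_number_Cons[OF xy, of L' f] z_def[symmetric]
        using IH1 IH2[OF False] disj inj2 by (simp add: card_image card_Un_disjoint)
    qed
  qed
qed

section \<open>Triangulations of an interval and binary trees\<close>

text \<open>For the tree-like part of the argument a segment is the ordered pair of its end points, and
  the sides and the root edge are counted among the segments of a triangulation. A leaf is a
  side; an inner node is a triangle hanging off its longest edge.\<close>

primrec edges :: "nat \<Rightarrow> bintree \<Rightarrow> (nat \<times> nat) set" where
  "edges p Leaf = {(p, p + 1)}"
| "edges p (Node l r) = insert (p, p + leaves (Node l r)) (edges p l \<union> edges (p + leaves l) r)"

lemma edges_bounds: "(i, j) \<in> edges p t \<Longrightarrow> p \<le> i \<and> i < j \<and> j \<le> p + leaves t"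
proof (induction t arbitrary: p)
  case (Node l r)
  then show ?case by (fastforce simp: add.assoc)
qed simp

lemma root_edge: "(p, p + leaves t) \<in> edges p t"
  by (cases t) auto

lemma consecutive_edges: "p \<le> i \<Longrightarrow> i < p + leaves t \<Longrightarrow> (i, Suc i) \<in> edges p t"
proof (induction t arbitrary: p)
  case (Node l r)
  then show ?case by (cases "i < p + leaves l") auto
qed simp

definition crossing_pairs :: "nat \<times> nat \<Rightarrow> nat \<times> nat \<Rightarrow> bool" where
  "crossing_pairs d d' \<longleftrightarrow>
     (fst d < fst d' \<and> fst d' < snd d \<and> snd d < snd d') \<or>
     (fst d' < fst d \<and> fst d < snd d' \<and> snd d' < snd d)"

text \<open>For a noncrossing set, containing every pair that crosses no member is the same as
  maximality. This pointwise form can be restricted to a subinterval.\<close>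

definition saturated :: "nat \<Rightarrow> nat \<Rightarrow> (nat \<times> nat) set \<Rightarrow> bool" where
  "saturated p q E \<longleftrightarrow>
     (\<forall>(i, j)\<in>E. p \<le> i \<and> i < j \<and> j \<le> q) \<and>
     (\<forall>d\<in>E. \<forall>d'\<in>E. \<not> crossing_pairs d d') \<and>
     (\<forall>i j. p \<le> i \<longrightarrow> i < j \<longrightarrow> j \<le> q \<longrightarrow> (\<forall>d\<in>E. \<not> crossing_pairs (i, j) d) \<longrightarrow> (i, j) \<in> E)"

lemma saturated_bounds: "saturated p q E \<Longrightarrow> (i, j) \<in> E \<Longrightarrow> p \<le> i \<and> i < j \<and> j \<le> q"
  unfolding saturated_def by blast

lemma saturated_noncrossing:
  "saturated p q E \<Longrightarrow> (i, j) \<in> E \<Longrightarrow> (k, l) \<in> E \<Longrightarrow> \<not> (i < k \<and> k < j \<and> j < l)"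
  unfolding saturated_def crossing_pairs_def by fastforce

lemma saturatedI:
  assumes "\<And>i j. (i, j) \<in> E \<Longrightarrow> p \<le> i \<and> i < j \<and> j \<le> q"
    and "\<And>i j k l. (i, j) \<in> E \<Longrightarrow> (k, l) \<in> E \<Longrightarrow> i < k \<Longrightarrow> k < j \<Longrightarrow> j < l \<Longrightarrow> False"
    and "\<And>i j. p \<le> i \<Longrightarrow> i < j \<Longrightarrow> j \<le> q \<Longrightarrow>
      (\<And>k l. (k, l) \<in> E \<Longrightarrow> \<not> (i < k \<and> k < j \<and> j < l) \<and> \<not> (k < i \<and> i < l \<and> l < j)) \<Longrightarrow> (i, j) \<in> E"
  shows "saturated p q E"
proof -
  have "\<forall>d\<in>E. \<forall>d'\<in>E. \<not> crossing_pairs d d'"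
    unfolding crossing_pairs_def using assms(2) by (metis prod.collapse)
  moreover have "(i, j) \<in> E" if "p \<le> i" "i < j" "j \<le> q" "\<forall>d\<in>E. \<not> crossing_pairs (i, j) d" for i j
    using assms(3)[OF that(1-3)] that(4) unfolding crossing_pairs_def by fastforce
  ultimately show ?thesis
    unfolding saturated_def using assms(1) by blast
qed

lemma saturatedD:
  assumes "saturated p q E" "p \<le> i" "i < j" "j \<le> q"
    and "\<And>k l. (k, l) \<in> E \<Longrightarrow> \<not> (i < k \<and> k < j \<and> j < l) \<and> \<not> (k < i \<and> i < l \<and> l < j)"
  shows "(i, j) \<in> E"
proof -
  have "\<forall>d\<in>E. \<not> crossing_pairs (i, j) d"
    using assms(5) by (auto simp: crossing_pairs_def)
  then show ?thesis using assms(1-4) unfolding saturated_def by blast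
qed

lemma edges_noncrossing:
  "(i, j) \<in> edges p t \<Longrightarrow> (k, l) \<in> edges p t \<Longrightarrow> i < k \<Longrightarrow> k < j \<Longrightarrow> j < l \<Longrightarrow> False"
proof (induction t arbitrary: p)
  case Leaf
  then show ?case by simp
next
  case (Node u v)
  have bl: "(i, j) \<in> edges p u \<Longrightarrow> p \<le> i \<and> i < j \<and> j \<le> p + leaves u" for i j
    by (rule edges_bounds)
  have br: "(i, j) \<in> edges (p + leaves u) v \<Longrightarrow>
    p + leaves u \<le> i \<and> i < j \<and> j \<le> p + leaves u + leaves v" for i j
    by (rule edges_bounds)
  have "(i, j) = (p, p + leaves u + leaves v) \<or> (i, j) \<in> edges p u \<or> (i, j) \<in> edges (p + leaves u) v"
    "(k, l) = (p, p + leaves u + leaves v) \<or> (k, l) \<in> edges p u \<or> (k, l) \<in> edges (p + leaves u) v"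
    using Node.prems by (auto simp: add.assoc)
  then show ?case
    using bl[of i j] bl[of k l] br[of i j] br[of k l] Node.IH(1)[of p] Node.IH(2)[of "p + leaves u"]
      Node.prems(3-5)
    by (elim disjE) auto
qed

lemma saturated_edges: "saturated p (p + leaves t) (edges p t)"
proof (induction t arbitrary: p)
  case Leaf
  show ?case by (rule saturatedI) auto
next
  case (Node u v)
  let ?m = "p + leaves u" and ?q = "p + leaves (Node u v)"
  show ?case
  proof (rule saturatedI)
    fix i j assume ij: "p \<le> i" "i < j" "j \<le> ?q"
      and nc: "\<And>k l. (k, l) \<in> edges p (Node u v) \<Longrightarrow>
        \<not> (i < k \<and> k < j \<and> j < l) \<and> \<not> (k < i \<and> i < l \<and> l < j)"
    have root: "(p, ?m) \<in> edges p (Node u v)" "(?m, ?q) \<in> edges p (Node u v)"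
      using root_edge[of p u] root_edge[of ?m v] by (auto simp: add.assoc)
    consider "j \<le> ?m" | "?m \<le> i" | "i < ?m" "?m < j" by linarith
    then show "(i, j) \<in> edges p (Node u v)"
    proof cases
      case 1
      have "(i, j) \<in> edges p u"
        by (rule saturatedD[OF Node.IH(1)]) (use ij 1 nc in auto)
      then show ?thesis by simp
    next
      case 2
      have "(i, j) \<in> edges ?m v"
        by (rule saturatedD[OF Node.IH(2)]) (use ij 2 nc in \<open>auto simp: add.assoc\<close>)
      then show ?thesis by simp
    next
      \<comment> \<open>For a pair straddling the apex, not crossing the edge from \<open>p\<close>
        to the apex forces \<open>i = p\<close>, and not crossing the edge from the apex forces
        \<open>j = ?q\<close>.\<close>
      case 3
      then have "i = p" "j = ?q"
        using nc[OF root(1)] nc[OF root(2)] ij by auto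
      then show ?thesis by simp
    qed
  qed (fact edges_bounds, fact edges_noncrossing)
qed

text \<open>The apex of the triangle at the root edge \<open>{p, q}\<close> is the farthest vertex \<open>m < q\<close> joined
  to \<open>p\<close>: an edge preventing \<open>{m, q}\<close> from being present would cross \<open>{p, m}\<close> or start at \<open>p\<close>.\<close>

lemma saturated_apex:
  assumes sat: "saturated p q E" and pq: "Suc p < q"
  obtains m where "p < m" "m < q" "(p, m) \<in> E" "(m, q) \<in> E"
    "\<And>i j. (i, j) \<in> E \<Longrightarrow> (i, j) = (p, q) \<or> j \<le> m \<or> m \<le> i"
proof -
  note bd = saturated_bounds[OF sat] and nc = saturated_noncrossing[OF sat]
  let ?M = "{j. (p, j) \<in> E \<and> j < q}"
  have "(p, Suc p) \<in> E"
  proof (rule saturatedD[OF sat])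
    fix k l assume "(k, l) \<in> E"
    then show "\<not> (p < k \<and> k < Suc p \<and> Suc p < l) \<and> \<not> (k < p \<and> p < l \<and> l < Suc p)"
      by auto
  qed (use pq in auto)
  then have ne: "?M \<noteq> {}" using pq by auto
  have fin: "finite ?M" by simp
  define m where "m = Max ?M"
  have m: "(p, m) \<in> E" "m < q" using Max_in[OF fin ne] by (auto simp: m_def)
  have mx: "j \<le> m" if "(p, j) \<in> E" "j < q" for j
    using Max_ge[OF fin] that by (auto simp: m_def)
  have "p < m" using bd m by blast
  have split: "(i, j) = (p, q) \<or> j \<le> m \<or> m \<le> i" if "(i, j) \<in> E" for i j
  proof (rule ccontr)
    assume neg: "\<not> ?thesis"
    then have "i < m" "m < j" by auto
    then have "i = p" using nc[OF m(1) that] bd[OF that] by auto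
    then show False using mx[of j] neg bd[OF that] that by auto
  qed
  have "(m, q) \<in> E"
  proof (rule saturatedD[OF sat])
    fix k l assume kl: "(k, l) \<in> E"
    show "\<not> (m < k \<and> k < q \<and> q < l) \<and> \<not> (k < m \<and> m < l \<and> l < q)"
      using split[OF kl] bd[OF kl] by auto
  qed (use m \<open>p < m\<close> in auto)
  then show ?thesis using that \<open>p < m\<close> m split by blast
qed

lemma saturated_root:
  assumes "saturated p q E" "p < q"
  shows "(p, q) \<in> E"
proof (rule saturatedD[OF assms(1)])
  fix k l assume "(k, l) \<in> E"
  then show "\<not> (p < k \<and> k < q \<and> q < l) \<and> \<not> (k < p \<and> p < l \<and> l < q)"
    using saturated_bounds[OF assms(1), of k l] by auto
qed (use assms in auto)

text \<open>An edge that leaves the interval lies beside it or spans it, so it crosses no pair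
  inside. Testing a pair against the remaining edges is therefore enough.\<close>

lemma saturated_restrict:
  assumes sat: "saturated p q E" and ab: "p \<le> a" "a < b" "b \<le> q"
    and split: "\<And>i j. (i, j) \<in> E \<Longrightarrow> j \<le> a \<or> b \<le> i \<or> (a \<le> i \<and> j \<le> b) \<or> (i \<le> a \<and> b \<le> j)"
  shows "saturated a b {(i, j) \<in> E. a \<le> i \<and> j \<le> b}"
proof (rule saturatedI)
  fix i j assume ij: "a \<le> i" "i < j" "j \<le> b"
    and nc: "\<And>k l. (k, l) \<in> {(i, j) \<in> E. a \<le> i \<and> j \<le> b} \<Longrightarrow>
      \<not> (i < k \<and> k < j \<and> j < l) \<and> \<not> (k < i \<and> i < l \<and> l < j)"
  have "(i, j) \<in> E"
  proof (rule saturatedD[OF sat])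
    fix k l assume kl: "(k, l) \<in> E"
    show "\<not> (i < k \<and> k < j \<and> j < l) \<and> \<not> (k < i \<and> i < l \<and> l < j)"
      using split[OF kl] nc[of k l] kl ij by auto
  qed (use ij ab in auto)
  then show "(i, j) \<in> {(i, j) \<in> E. a \<le> i \<and> j \<le> b}" using ij by simp
qed (use saturated_bounds[OF sat] saturated_noncrossing[OF sat] in auto)

text \<open>The converse of \<open>saturated_edges\<close>: the apex cuts the interval into two
  shorter ones on which the set is again saturated.\<close>

lemma saturated_is_edges:
  "saturated p q E \<Longrightarrow> p < q \<Longrightarrow> \<exists>t. p + leaves t = q \<and> edges p t = E"
proof (induction "q - p" arbitrary: p q E rule: less_induct)
  case less
  note sat = less.prems(1)
  note bd = saturated_bounds[OF sat]
  have root: "(p, q) \<in> E" by (rule saturated_root[OF less.prems])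
  show ?case
  proof (cases "q = Suc p")
    case True
    have "E = {(p, Suc p)}"
      using root bd True by (auto simp: le_antisym Suc_leI) (metis Suc_leI le_antisym less_le_trans not_less_eq_eq)+
    then show ?thesis using True by (intro exI[of _ Leaf]) auto
  next
    case False
    with less.prems have "Suc p < q" by simp
    then obtain m where m: "p < m" "m < q" "(p, m) \<in> E" "(m, q) \<in> E"
      and split: "\<And>i j. (i, j) \<in> E \<Longrightarrow> (i, j) = (p, q) \<or> j \<le> m \<or> m \<le> i"
      using saturated_apex[OF sat] by metis
    have satl: "saturated p m {(i, j) \<in> E. p \<le> i \<and> j \<le> m}"
      by (rule saturated_restrict[OF sat]) (use m split bd in fastforce)+
    have satr: "saturated m q {(i, j) \<in> E. m \<le> i \<and> j \<le> q}"
      by (rule saturated_restrict[OF sat]) (use m split bd in fastforce)+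
    have "m - p < q - p" "q - m < q - p" using m by auto
    then obtain l r where l: "p + leaves l = m" "edges p l = {(i, j) \<in> E. p \<le> i \<and> j \<le> m}"
      and r: "m + leaves r = q" "edges m r = {(i, j) \<in> E. m \<le> i \<and> j \<le> q}"
      using less.hyps[OF _ satl m(1)] less.hyps[OF _ satr m(2)] by blast
    have "edges p (Node l r) = insert (p, q) (edges p l \<union> edges m r)"
      using l(1) r(1) by (simp add: add.assoc[symmetric])
    also have "\<dots> = E"
    proof (intro equalityI subsetI)
      fix d assume "d \<in> insert (p, q) (edges p l \<union> edges m r)"
      then show "d \<in> E" using root unfolding l r by auto
    next
      fix d assume d: "d \<in> E"
      obtain i j where ij: "d = (i, j)" by (cases d)
      show "d \<in> insert (p, q) (edges p l \<union> edges m r)"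
        using d split[of i j] bd[of i j] unfolding l r ij by auto
    qed
    finally show ?thesis using l(1) r(1) by (intro exI[of _ "Node l r"]) auto
  qed
qed

text \<open>The subtrees can be recovered from the whole edge set and the apex. This yields
  injectivity of \<open>edges\<close> and places each triangle in one subtree.\<close>

lemma edges_Node_left: "edges p l = {(i, j) \<in> edges p (Node l r). j \<le> p + leaves l}"
proof -
  have "j \<le> p + leaves l" if "(i, j) \<in> edges p l" for i j
    using edges_bounds[OF that] by simp
  moreover have "\<not> j \<le> p + leaves l" if "(i, j) \<in> edges (p + leaves l) r" for i j
    using edges_bounds[OF that] by simp
  ultimately show ?thesis by auto
qed

lemma edges_Node_right: "edges (p + leaves l) r = {(i, j) \<in> edges p (Node l r). p + leaves l \<le> i}"
proof -
  have "\<not> p + leaves l \<le> i" if "(i, j) \<in> edges p l" for i j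
    using edges_bounds[OF that] by simp
  moreover have "p + leaves l \<le> i" if "(i, j) \<in> edges (p + leaves l) r" for i j
    using edges_bounds[OF that] by simp
  ultimately show ?thesis by auto
qed

text \<open>An edge from \<open>p\<close> other than the root edge lies in the left tree, so
  \<open>j\<close> is at most the apex; an edge into the last vertex other than the root edge lies
  in the right tree, so \<open>j\<close> is at least the apex.\<close>

lemma edges_apex_unique:
  assumes "(p, j) \<in> edges p (Node l r)" "(j, p + leaves (Node l r)) \<in> edges p (Node l r)"
  shows "j = p + leaves l"
  using assms edges_bounds[of p j p l] edges_bounds[of p j "p + leaves l" r]
    edges_bounds[of j "p + leaves (Node l r)" p l]
    edges_bounds[of j "p + leaves (Node l r)" "p + leaves l" r]
  by (auto simp: le_antisym)

lemma edges_Node_apex: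
  "(p, p + leaves l) \<in> edges p (Node l r)"
  "(p + leaves l, p + leaves (Node l r)) \<in> edges p (Node l r)"
  using root_edge[of p l] root_edge[of "p + leaves l" r] by (auto simp: add.assoc)

lemma leaves_1_iff: "leaves t = Suc 0 \<longleftrightarrow> t = Leaf"
proof (cases t)
  case (Node l r)
  then show ?thesis using leaves_pos[of l] leaves_pos[of r] by (simp del: leaves_pos leaves_neq_0)
qed simp

lemma edges_inject: "edges p t = edges p t' \<Longrightarrow> leaves t = leaves t' \<Longrightarrow> t = t'"
proof (induction t arbitrary: p t')
  case Leaf
  from Leaf.prems(2) have "leaves t' = Suc 0" by simp
  then show ?case by (metis leaves_1_iff)
next
  case (Node l r)
  then obtain l' r' where t': "t' = Node l' r'"
    using leaves_1_iff[of "Node l r"] by (cases t') auto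
  have E: "edges p (Node l r) = edges p (Node l' r')" and len: "leaves (Node l r) = leaves (Node l' r')"
    using Node.prems t' by auto
  have "p + leaves l = p + leaves l'"
    using edges_Node_apex[of p l r] unfolding E len by (rule edges_apex_unique)
  then have lv: "leaves l = leaves l'" by simp
  have "edges p l = edges p l'"
    by (simp only: edges_Node_left[of p l r] edges_Node_left[of p l' r'] E lv)
  then have "l = l'" using lv by (rule Node.IH(1))
  moreover have "edges (p + leaves l) r = edges (p + leaves l) r'"
    by (simp only: edges_Node_right[of p l r] edges_Node_right[of p l' r', folded lv] E)
  then have "r = r'"
    by (rule Node.IH(2)) (use len lv in simp)
  ultimately show ?case using t' by simp
qed

section \<open>Colourings that are injective on triangles\<close>

definition rainbow :: "(nat \<times> nat) set \<Rightarrow> (nat \<Rightarrow> colour) \<Rightarrow> bool" where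
  "rainbow E c \<longleftrightarrow>
     (\<forall>i j k. (i, j) \<in> E \<longrightarrow> (j, k) \<in> E \<longrightarrow> (i, k) \<in> E \<longrightarrow> c i \<noteq> c j \<and> c j \<noteq> c k \<and> c i \<noteq> c k)"

text \<open>A triangle i < j < k lies in the part containing its longest edge (i, k). If that is the
  root edge, the middle vertex is the apex.\<close>

lemma rainbow_Node:
  "rainbow (edges p (Node l r)) c \<longleftrightarrow>
     rainbow (edges p l) c \<and> rainbow (edges (p + leaves l) r) c \<and>
     c p \<noteq> c (p + leaves l) \<and> c (p + leaves l) \<noteq> c (p + leaves (Node l r)) \<and> c p \<noteq> c (p + leaves (Node l r))"
    (is "rainbow ?E c \<longleftrightarrow> ?R")
proof
  assume rb: "rainbow ?E c"
  then have "rainbow (edges p l) c" "rainbow (edges (p + leaves l) r) c"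
    unfolding rainbow_def by simp_all
  moreover have "c p \<noteq> c (p + leaves l) \<and> c (p + leaves l) \<noteq> c (p + leaves (Node l r)) \<and>
      c p \<noteq> c (p + leaves (Node l r))"
    using rb edges_Node_apex[of p l r] root_edge[of p "Node l r"] unfolding rainbow_def by blast
  ultimately show ?R by simp
next
  assume R: ?R
  show "rainbow ?E c"
    unfolding rainbow_def
  proof (intro allI impI)
    fix i j k assume E: "(i, j) \<in> ?E" "(j, k) \<in> ?E" "(i, k) \<in> ?E"
    have lt: "i < j" "j < k" using E edges_bounds by blast+
    consider "(i, k) = (p, p + leaves (Node l r))" | "(i, k) \<in> edges p l" | "(i, k) \<in> edges (p + leaves l) r"
      using E(3) by auto
    then show "c i \<noteq> c j \<and> c j \<noteq> c k \<and> c i \<noteq> c k"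
    proof cases
      case 1
      then have "j = p + leaves l" using E edges_apex_unique by blast
      then show ?thesis using 1 R by auto
    next
      case 2
      then have "k \<le> p + leaves l" using edges_bounds by blast
      then have "(i, j) \<in> edges p l" "(j, k) \<in> edges p l"
        unfolding edges_Node_left[of p l r] using E lt by auto
      then show ?thesis using 2 R unfolding rainbow_def by blast
    next
      case 3
      then have "p + leaves l \<le> i" using edges_bounds by blast
      then have "(i, j) \<in> edges (p + leaves l) r" "(j, k) \<in> edges (p + leaves l) r"
        unfolding edges_Node_right[of p l r] using E lt by auto
      then show ?thesis using 3 R unfolding rainbow_def by blast
    qed
  qed
qed

text \<open>The apex is forced to have the third colour, and so on recursively. The list stops
  before the last vertex, so that the words of the two subtrees concatenate without repeating the
  apex.\<close>

lemma rainbow_iff: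
  assumes "x \<noteq> y"
  shows "c p = x \<and> c (p + leaves t) = y \<and> rainbow (edges p t) c \<longleftrightarrow>
    map c [p..<p + leaves t] = x # inner_colours x y t \<and> c (p + leaves t) = y"
  using assms
proof (induction t arbitrary: p x y)
  case Leaf
  show ?case by (simp add: rainbow_def)
next
  case (Node l r)
  define z where "z = third x y"
  let ?m = "p + leaves l" and ?q = "p + leaves (Node l r)"
  have q: "?q = ?m + leaves r" by simp
  have xz: "x \<noteq> z" and zy: "z \<noteq> y" using third_simps[OF Node.prems] by (auto simp: z_def)
  have zu: "c ?m \<noteq> x \<Longrightarrow> c ?m \<noteq> y \<Longrightarrow> c ?m = z"
    unfolding z_def by (rule third_unique[OF Node.prems])
  have upt: "[p..<?q] = [p..<?m] @ [?m..<?q]"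
    unfolding q by (rule upt_add_eq_append) simp
  have hd: "c ?m = w" if "map c [?m..<?q] = w # ws" for w ws
    using that leaves_pos[of r] unfolding q by (simp add: upt_conv_Cons)
  have "c p = x \<and> c ?q = y \<and> rainbow (edges p (Node l r)) c \<longleftrightarrow>
    (c p = x \<and> c ?m = z \<and> rainbow (edges p l) c) \<and> (c ?m = z \<and> c ?q = y \<and> rainbow (edges ?m r) c)"
    unfolding rainbow_Node using zu xz zy Node.prems by metis
  also have "\<dots> \<longleftrightarrow> (map c [p..<?m] = x # inner_colours x z l \<and> c ?m = z) \<and>
    (map c [?m..<?q] = z # inner_colours z y r \<and> c ?q = y)"
    by (simp only: q Node.IH(1)[OF xz, of p] Node.IH(2)[OF zy, of ?m])
  also have "\<dots> \<longleftrightarrow> map c [p..<?m] = x # inner_colours x z l \<and>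
    map c [?m..<?q] = z # inner_colours z y r \<and> c ?q = y"
    using hd[of z "inner_colours z y r"] by argo
  also have "\<dots> \<longleftrightarrow> map c [p..<?m] @ map c [?m..<?q] = (x # inner_colours x z l) @ (z # inner_colours z y r) \<and> c ?q = y"
  proof -
    \<comment> \<open>Equal lengths of the left halves allow the equation of concatenations to be
      split again.\<close>
    have "length (map c [p..<?m]) = length (x # inner_colours x z l)"
      by (simp add: length_inner_colours)
    then show ?thesis by (simp only: append_eq_append_conv[OF disjI1] conj_assoc)
  qed
  also have "\<dots> \<longleftrightarrow> map c [p..<?q] = x # inner_colours x y (Node l r) \<and> c ?q = y"
    by (simp only: upt map_append inner_colours.simps z_def append_Cons)
  finally show ?case .
qed

section \<open>Triangulations as maximal noncrossing sets of diagonals\<close>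

lemma side_iff:
  assumes "i < j"
  shows "{i, j} \<in> sides n \<longleftrightarrow> j \<le> n + 1 \<and> (j = Suc i \<or> i = 0 \<and> j = n + 1)"
proof
  assume "{i, j} \<in> sides n"
  then obtain v where v: "v < n + 2" "{i, j} = {v, Suc v mod (n + 2)}"
    by (auto simp: sides_def vertices_def)
  then show "j \<le> n + 1 \<and> (j = Suc i \<or> i = 0 \<and> j = n + 1)"
    using assms by (cases "v = n + 1") (auto simp: doubleton_eq_iff)
next
  assume R: "j \<le> n + 1 \<and> (j = Suc i \<or> i = 0 \<and> j = n + 1)"
  show "{i, j} \<in> sides n"
  proof (cases "j = Suc i")
    case True
    then have "{i, j} = {i, Suc i mod (n + 2)}" "i \<in> vertices n"
      using R by (auto simp: vertices_def)
    then show ?thesis unfolding sides_def by blast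
  next
    case False
    then have "{i, j} = {n + 1, Suc (n + 1) mod (n + 2)}" "n + 1 \<in> vertices n"
      using R by (auto simp: vertices_def)
    then show ?thesis unfolding sides_def by blast
  qed
qed

lemma crossing_sym: "crossing d d' \<longleftrightarrow> crossing d' d"
  unfolding crossing_def by blast

lemma crossing_iff:
  assumes "i < j" "k < l"
  shows "crossing {i, j} {k, l} \<longleftrightarrow> i < k \<and> k < j \<and> j < l \<or> k < i \<and> i < l \<and> l < j"
proof
  assume "crossing {i, j} {k, l}"
  then obtain a b c d where "a < b" "b < c" "c < d"
    "{i, j} = {a, c} \<and> {k, l} = {b, d} \<or> {i, j} = {b, d} \<and> {k, l} = {a, c}"
    unfolding crossing_def by blast
  then show "i < k \<and> k < j \<and> j < l \<or> k < i \<and> i < l \<and> l < j"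
    using assms by (auto simp: doubleton_eq_iff)
next
  assume "i < k \<and> k < j \<and> j < l \<or> k < i \<and> i < l \<and> l < j"
  then show "crossing {i, j} {k, l}"
    unfolding crossing_def by blast
qed

lemma side_not_crossing:
  assumes "{i, j} \<in> sides n" "i < j" "k < l" "l \<le> n + 1"
  shows "\<not> crossing {i, j} {k, l}" "\<not> crossing {k, l} {i, j}"
  using assms by (auto simp: crossing_iff side_iff)

lemma card_2_less:
  fixes d :: "nat set"
  assumes "card d = 2"
  obtains i j where "i < j" "d = {i, j}"
proof -
  obtain x y where "d = {x, y}" "x \<noteq> y" using assms by (auto simp: card_2_iff)
  then show ?thesis using that[of x y] that[of y x] by (cases "x < y") (auto simp: insert_commute)
qed

lemma diagonalsE:
  assumes "d \<in> diagonals n"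
  obtains i j where "i < j" "j \<le> n + 1" "d = {i, j}" "d \<notin> sides n"
  using assms card_2_less[of d] unfolding diagonals_def vertices_def
  by (smt (verit) CollectD Suc_eq_plus1 add_2_eq_Suc' insert_subset lessThan_iff less_Suc_eq_le)

lemma diagonalsI: "i < j \<Longrightarrow> j \<le> n + 1 \<Longrightarrow> {i, j} \<notin> sides n \<Longrightarrow> {i, j} \<in> diagonals n"
  by (auto simp: diagonals_def vertices_def)

definition pairs_of :: "nat \<Rightarrow> nat set set \<Rightarrow> (nat \<times> nat) set" where
  "pairs_of n D = {(i, j). i < j \<and> {i, j} \<in> sides n \<union> D}"

definition diagonals_of :: "nat \<Rightarrow> (nat \<times> nat) set \<Rightarrow> nat set set" where
  "diagonals_of n E = (\<lambda>(i, j). {i, j}) ` E - sides n"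

lemma pairs_of_bounds:
  assumes "D \<subseteq> diagonals n" "(i, j) \<in> pairs_of n D"
  shows "i < j" "j \<le> n + 1"
proof -
  show "i < j" using assms by (simp add: pairs_of_def)
  have "{i, j} \<in> sides n \<or> {i, j} \<in> D" using assms by (simp add: pairs_of_def)
  then show "j \<le> n + 1"
  proof
    assume "{i, j} \<in> sides n"
    then show ?thesis using side_iff[OF \<open>i < j\<close>] by blast
  next
    assume "{i, j} \<in> D"
    then have "{i, j} \<subseteq> vertices n" using assms(1) unfolding diagonals_def by blast
    then show ?thesis by (simp add: vertices_def)
  qed
qed

lemma diagonals_of_pairs_of:
  assumes "D \<subseteq> diagonals n"
  shows "diagonals_of n (pairs_of n D) = D"
proof (intro equalityI subsetI)
  fix d assume "d \<in> D"
  then have "d \<in> diagonals n" using assms by blast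
  then obtain i j where "i < j" "d = {i, j}" "d \<notin> sides n" by (rule diagonalsE)
  then show "d \<in> diagonals_of n (pairs_of n D)"
    using \<open>d \<in> D\<close> unfolding diagonals_of_def pairs_of_def by blast
qed (auto simp: diagonals_of_def pairs_of_def)

text \<open>Sides cross nothing, so two crossing pairs would both be diagonals of \<open>D\<close>;
  a diagonal crossing no member could be added to \<open>D\<close>.\<close>

lemma saturated_pairs_of:
  assumes "D \<in> triangulations n"
  shows "saturated 0 (n + 1) (pairs_of n D)"
proof -
  have D: "D \<subseteq> diagonals n" and nc: "noncrossing D"
    and mx: "\<And>D'. D \<subseteq> D' \<Longrightarrow> D' \<subseteq> diagonals n \<Longrightarrow> noncrossing D' \<Longrightarrow> D' = D"
    using assms unfolding triangulations_def by auto
  note bd = pairs_of_bounds[OF D]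
  show ?thesis
  proof (rule saturatedI)
    fix i j k l assume ij: "(i, j) \<in> pairs_of n D" and kl: "(k, l) \<in> pairs_of n D"
      and lt: "i < k" "k < j" "j < l"
    have cr: "crossing {i, j} {k, l}" using lt by (simp add: crossing_iff)
    have "{i, j} \<notin> sides n" "{k, l} \<notin> sides n"
      using side_not_crossing cr bd[OF ij] bd[OF kl] by blast+
    then have "{i, j} \<in> D" "{k, l} \<in> D"
      using ij kl by (auto simp: pairs_of_def)
    then show False using nc cr unfolding noncrossing_def by blast
  next
    fix i j assume ij: "0 \<le> i" "i < j" "j \<le> n + 1"
      and no: "\<And>k l. (k, l) \<in> pairs_of n D \<Longrightarrow>
        \<not> (i < k \<and> k < j \<and> j < l) \<and> \<not> (k < i \<and> i < l \<and> l < j)"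
    show "(i, j) \<in> pairs_of n D"
    proof (cases "{i, j} \<in> sides n")
      case True
      then show ?thesis using ij by (simp add: pairs_of_def)
    next
      case False
      have "\<not> crossing {i, j} d" if d: "d \<in> D" for d
      proof -
        obtain k l where kl: "k < l" "d = {k, l}" using D d diagonalsE by blast
        then have "(k, l) \<in> pairs_of n D" using d by (simp add: pairs_of_def)
        then show ?thesis using no[of k l] kl ij by (auto simp: crossing_iff)
      qed
      moreover have "\<not> crossing {i, j} {i, j}" using ij by (simp add: crossing_iff)
      ultimately have "noncrossing (insert {i, j} D)"
        using nc crossing_sym unfolding noncrossing_def by blast
      moreover have "insert {i, j} D \<subseteq> diagonals n"
        using D diagonalsI[OF ij(2,3) False] by blast
      ultimately have "insert {i, j} D = D" using mx[of "insert {i, j} D"] by blast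
      then have "{i, j} \<in> D" by blast
      then show ?thesis using ij by (simp add: pairs_of_def)
    qed
  qed (use bd in auto)
qed

text \<open>The sides discarded by \<open>diagonals_of\<close> come back, because a tree with n + 1
  leaves contains all consecutive pairs and the root edge (0, n + 1).\<close>

lemma pairs_of_diagonals_of_edges:
  assumes "leaves t = n + 1"
  shows "pairs_of n (diagonals_of n (edges 0 t)) = edges 0 t"
proof (intro equalityI subsetI)
  fix d assume d: "d \<in> pairs_of n (diagonals_of n (edges 0 t))"
  obtain i j where ij: "d = (i, j)" by (cases d)
  have "i < j" using d ij by (simp add: pairs_of_def)
  show "d \<in> edges 0 t"
  proof (cases "{i, j} \<in> sides n")
    case True
    then show ?thesis
      using side_iff[OF \<open>i < j\<close>, of n] consecutive_edges[of 0 i t] root_edge[of 0 t] assms ij by auto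
  next
    case False
    then obtain k l where kl: "(k, l) \<in> edges 0 t" "{i, j} = {k, l}"
      using d ij by (auto simp: pairs_of_def diagonals_of_def)
    then have "k < l" using edges_bounds by blast
    then show ?thesis using kl \<open>i < j\<close> ij by (auto simp: doubleton_eq_iff)
  qed
next
  fix d assume d: "d \<in> edges 0 t"
  obtain i j where ij: "d = (i, j)" by (cases d)
  then have "i < j" using d edges_bounds by blast
  then show "d \<in> pairs_of n (diagonals_of n (edges 0 t))"
    using d ij by (auto simp: pairs_of_def diagonals_of_def)
qed

lemma diagonals_of_edges_triangulation:
  assumes t: "leaves t = n + 1"
  shows "diagonals_of n (edges 0 t) \<in> triangulations n"
proof -
  let ?D = "diagonals_of n (edges 0 t)"
  have sat: "saturated 0 (n + 1) (edges 0 t)" using saturated_edges[of 0 t] t by simp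
  have elem: "\<exists>i j. (i, j) \<in> edges 0 t \<and> d = {i, j} \<and> i < j \<and> j \<le> n + 1 \<and> d \<notin> sides n" if d: "d \<in> ?D" for d
  proof -
    obtain i j where "(i, j) \<in> edges 0 t" "d = {i, j}" "d \<notin> sides n"
      using d unfolding diagonals_of_def by auto
    then show ?thesis using saturated_bounds[OF sat] by blast
  qed
  have "?D \<subseteq> diagonals n" using elem diagonalsI by blast
  moreover have "noncrossing ?D"
    unfolding noncrossing_def
  proof (intro ballI)
    fix d d' assume "d \<in> ?D" "d' \<in> ?D"
    then obtain i j k l where "(i, j) \<in> edges 0 t" "d = {i, j}" "i < j" "(k, l) \<in> edges 0 t" "d' = {k, l}" "k < l"
      using elem by meson
    then show "\<not> crossing d d'"
      using saturated_noncrossing[OF sat, of i j k l] saturated_noncrossing[OF sat, of k l i j] by (auto simp: crossing_iff)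
  qed
  moreover have "D' = ?D" if sub: "?D \<subseteq> D'" and D': "D' \<subseteq> diagonals n" and nc: "noncrossing D'" for D'
  proof (rule equalityI[OF _ sub], rule subsetI)
    fix d assume d: "d \<in> D'"
    then obtain i j where ij: "i < j" "j \<le> n + 1" "d = {i, j}" "d \<notin> sides n"
      using D' diagonalsE by blast
    \<comment> \<open>A further diagonal crosses no edge of the tree: sides cross nothing, and the
      other edges already lie in the noncrossing set \<open>D'\<close>.\<close>
    have "(i, j) \<in> edges 0 t"
    proof (rule saturatedD[OF sat])
      fix k l assume kl: "(k, l) \<in> edges 0 t"
      then have "k < l" using saturated_bounds[OF sat] by blast
      have "\<not> crossing {i, j} {k, l}"
      proof (cases "{k, l} \<in> sides n")
        case True
        then show ?thesis using side_not_crossing(2) \<open>k < l\<close> ij by blast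
      next
        case False
        then have "{k, l} \<in> ?D" unfolding diagonals_of_def using kl by auto
        then show ?thesis using nc sub d ij unfolding noncrossing_def by blast
      qed
      then show "\<not> (i < k \<and> k < j \<and> j < l) \<and> \<not> (k < i \<and> i < l \<and> l < j)"
        using ij \<open>k < l\<close> by (simp add: crossing_iff)
    qed (use ij in auto)
    then show "d \<in> ?D" using ij unfolding diagonals_of_def by auto
  qed
  ultimately show ?thesis unfolding triangulations_def by blast
qed

lemma triangulations_subset: "D \<in> triangulations n \<Longrightarrow> D \<subseteq> diagonals n"
  by (simp add: triangulations_def)

lemma bij_betw_triangulations:
  "bij_betw (\<lambda>t. diagonals_of n (edges 0 t)) {t. leaves t = n + 1} (triangulations n)"
proof (rule bij_betw_imageI)
  show "inj_on (\<lambda>t. diagonals_of n (edges 0 t)) {t. leaves t = n + 1}"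
  proof (rule inj_onI)
    fix t t' assume "t \<in> {t. leaves t = n + 1}" "t' \<in> {t. leaves t = n + 1}"
      "diagonals_of n (edges 0 t) = diagonals_of n (edges 0 t')"
    then have "edges 0 t = edges 0 t'" "leaves t = leaves t'"
      by (metis mem_Collect_eq pairs_of_diagonals_of_edges)+
    then show "t = t'" by (rule edges_inject)
  qed
  show "(\<lambda>t. diagonals_of n (edges 0 t)) ` {t. leaves t = n + 1} = triangulations n"
  proof (intro equalityI subsetI)
    fix D assume D: "D \<in> triangulations n"
    obtain t where "leaves t = n + 1" "edges 0 t = pairs_of n D"
      using saturated_is_edges[OF saturated_pairs_of[OF D]] by auto
    then show "D \<in> (\<lambda>t. diagonals_of n (edges 0 t)) ` {t. leaves t = n + 1}"
      using diagonals_of_pairs_of[OF triangulations_subset[OF D]] by (metis (mono_tags) image_eqI mem_Collect_eq)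
  qed (auto intro: diagonals_of_edges_triangulation)
qed

lemma card_3_less:
  fixes T :: "nat set"
  assumes "card T = 3"
  obtains i j k where "i < j" "j < k" "T = {i, j, k}"
proof -
  obtain x y z where T: "T = {x, y, z}" "x \<noteq> y" "y \<noteq> z" "x \<noteq> z"
    using assms by (auto simp: card_3_iff)
  consider "x < y" "y < z" | "x < z" "z < y" | "y < x" "x < z" | "y < z" "z < x"
    | "z < x" "x < y" | "z < y" "y < x"
    using T by linarith
  then show ?thesis
    by cases (use that T in \<open>auto simp: insert_commute\<close>)
qed

lemma rainbow_pairs_of:
  assumes D: "D \<subseteq> diagonals n"
  shows "(\<forall>T\<in>triangles n D. inj_on c T) \<longleftrightarrow> rainbow (pairs_of n D) c"
proof
  assume inj: "\<forall>T\<in>triangles n D. inj_on c T"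
  show "rainbow (pairs_of n D) c"
    unfolding rainbow_def
  proof (intro allI impI)
    fix i j k assume E: "(i, j) \<in> pairs_of n D" "(j, k) \<in> pairs_of n D" "(i, k) \<in> pairs_of n D"
    note bd = pairs_of_bounds[OF D E(1)] pairs_of_bounds[OF D E(2)]
    have "{i, j} \<in> sides n \<union> D" "{j, k} \<in> sides n \<union> D" "{i, k} \<in> sides n \<union> D"
      using E by (auto simp: pairs_of_def)
    then have "\<forall>x\<in>{i, j, k}. \<forall>y\<in>{i, j, k}. x \<noteq> y \<longrightarrow> {x, y} \<in> sides n \<union> D"
      by (simp add: insert_commute)
    moreover have "{i, j, k} \<subseteq> vertices n" "card {i, j, k} = 3"
      using bd by (auto simp: vertices_def)
    ultimately have "{i, j, k} \<in> triangles n D" unfolding triangles_def by blast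
    then have "inj_on c {i, j, k}" using inj by blast
    then show "c i \<noteq> c j \<and> c j \<noteq> c k \<and> c i \<noteq> c k" using bd by (auto simp: inj_on_def)
  qed
next
  assume rb: "rainbow (pairs_of n D) c"
  show "\<forall>T\<in>triangles n D. inj_on c T"
  proof
    fix T assume T: "T \<in> triangles n D"
    then have "card T = 3" by (simp add: triangles_def)
    then obtain i j k where ijk: "i < j" "j < k" "T = {i, j, k}" by (rule card_3_less)
    then have "{i, j} \<in> sides n \<union> D" "{j, k} \<in> sides n \<union> D" "{i, k} \<in> sides n \<union> D"
      using T by (auto simp: triangles_def)
    then have "(i, j) \<in> pairs_of n D" "(j, k) \<in> pairs_of n D" "(i, k) \<in> pairs_of n D"
      using ijk by (auto simp: pairs_of_def)
    then have "c i \<noteq> c j \<and> c j \<noteq> c k \<and> c i \<noteq> c k" using rb unfolding rainbow_def by blast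
    then show "inj_on c T" unfolding ijk(3) by (auto simp: inj_on_def)
  qed
qed

section \<open>Colourings of a triangulation as boundary words\<close>

definition boundary_colours :: "bintree \<Rightarrow> colour list" where
  "boundary_colours t = Col_b # inner_colours Col_b Col_c t @ [Col_c]"

text \<open>All colouring conditions become one equation of words, which gives existence, uniqueness
  and the colour counts at once.\<close>

lemma is_colouring_iff:
  assumes t: "leaves t = n + 1"
  shows "is_colouring n 0 (n + 1) (diagonals_of n (edges 0 t)) c \<longleftrightarrow>
    c \<in> extensional (vertices n) \<and> map c [0..<n + 2] = boundary_colours t"
proof -
  let ?D = "diagonals_of n (edges 0 t)"
  have D: "?D \<subseteq> diagonals n"
    by (rule triangulations_subset[OF diagonals_of_edges_triangulation[OF t]])
  have "c 0 = Col_b \<and> c (n + 1) = Col_c \<and> (\<forall>T\<in>triangles n ?D. inj_on c T) \<longleftrightarrow>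
    c 0 = Col_b \<and> c (0 + leaves t) = Col_c \<and> rainbow (edges 0 t) c"
    unfolding rainbow_pairs_of[OF D] pairs_of_diagonals_of_edges[OF t] t by simp
  also have "\<dots> \<longleftrightarrow> map c [0..<0 + leaves t] = Col_b # inner_colours Col_b Col_c t \<and> c (0 + leaves t) = Col_c"
    by (rule rainbow_iff) simp
  also have "\<dots> \<longleftrightarrow> map c [0..<n + 1] @ [c (n + 1)] = (Col_b # inner_colours Col_b Col_c t) @ [Col_c]"
    unfolding t by (simp only: append1_eq_conv add_0)
  also have "\<dots> \<longleftrightarrow> map c [0..<n + 2] = boundary_colours t"
    by (simp add: boundary_colours_def)
  finally show ?thesis
    unfolding is_colouring_def by (simp add: PiE_def)
qed

lemma ex1_colouring:
  assumes t: "leaves t = n + 1"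
  shows "\<exists>!c. is_colouring n 0 (n + 1) (diagonals_of n (edges 0 t)) c"
  unfolding is_colouring_iff[OF t]
proof (rule ex1I)
  let ?c = "restrict (\<lambda>v. boundary_colours t ! v) (vertices n)"
  have "length (boundary_colours t) = n + 2"
    using t by (simp add: boundary_colours_def length_inner_colours)
  then show "?c \<in> extensional (vertices n) \<and> map ?c [0..<n + 2] = boundary_colours t"
    by (auto simp: vertices_def intro!: nth_equalityI simp del: upt_Suc)
  show "c = ?c" if "c \<in> extensional (vertices n) \<and> map c [0..<n + 2] = boundary_colours t" for c
  proof (rule extensionalityI)
    fix v assume v: "v \<in> vertices n"
    have "c v = map c [0..<n + 2] ! v" using v by (simp add: vertices_def del: upt_Suc)
    then show "c v = ?c v" using v that by simp
  qed (use that in auto)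
qed

lemma num_coloured_eq_count:
  "num_coloured n c w = count_list (map c [0..<n + 2]) w"
proof -
  have "count_list (map c [0..<n + 2]) w = length (filter ((=) w) (map c [0..<n + 2]))"
    by (rule count_list_eq_length_filter)
  also have "\<dots> = card {v. v < n + 2 \<and> c v = w}"
    unfolding length_filter_conv_card by (rule arg_cong[where f = card]) (auto simp del: upt_Suc)
  finally show ?thesis by (simp add: num_coloured_def vertices_def)
qed

text \<open>Unique existence travels with the count because \<open>colouring\<close> is a
  \<open>THE\<close> term: without it, the colourings for two root edges cannot be compared.\<close>

definition correct_root :: "nat \<Rightarrow> (colour \<Rightarrow> nat) \<Rightarrow> real \<Rightarrow> nat \<Rightarrow> nat \<Rightarrow> bool" where
  "correct_root n f K s e \<longleftrightarrow>
     (\<forall>D\<in>triangulations n. \<exists>!c. is_colouring n s e D c) \<and>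
     real (card {D \<in> triangulations n. \<forall>w. num_coloured n (colouring n s e D) w = f w}) = K"

lemma correct_root_0:
  "correct_root n f
     (real (card {t. leaves t = n + 1 \<and> (\<forall>w. count_list (boundary_colours t) w = f w)})) 0 (n + 1)"
proof -
  let ?g = "\<lambda>t. diagonals_of n (edges 0 t)"
  note bij = bij_betw_triangulations[of n]
  have num: "num_coloured n (colouring n 0 (n + 1) (?g t)) w = count_list (boundary_colours t) w"
    if t: "leaves t = n + 1" for t w
  proof -
    have "is_colouring n 0 (n + 1) (?g t) (colouring n 0 (n + 1) (?g t))"
      unfolding colouring_def by (rule theI'[OF ex1_colouring[OF t]])
    then show ?thesis unfolding is_colouring_iff[OF t] num_coloured_eq_count by simp
  qed
  have img: "triangulations n = ?g ` {t. leaves t = n + 1}"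
    using bij by (simp add: bij_betw_def)
  have "{D \<in> triangulations n. \<forall>w. num_coloured n (colouring n 0 (n + 1) D) w = f w} =
    ?g ` {t. leaves t = n + 1 \<and> (\<forall>w. count_list (boundary_colours t) w = f w)}"
    unfolding img using num by auto
  moreover have "inj_on ?g {t. leaves t = n + 1 \<and> (\<forall>w. count_list (boundary_colours t) w = f w)}"
    using bij by (auto simp: bij_betw_def intro: inj_on_subset)
  ultimately show ?thesis
    unfolding correct_root_def using ex1_colouring img by (simp add: card_image)
qed

section \<open>Reflections of the polygon\<close>

locale polygon_symmetry =
  fixes n :: nat and h :: "nat \<Rightarrow> nat"
  assumes vertex: "v \<in> vertices n \<Longrightarrow> h v \<in> vertices n"
    and involution: "v \<in> vertices n \<Longrightarrow> h (h v) = v"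
    and side: "d \<in> sides n \<Longrightarrow> h ` d \<in> sides n"
    and crossing_image: "d \<subseteq> vertices n \<Longrightarrow> d' \<subseteq> vertices n \<Longrightarrow> crossing d d' \<Longrightarrow> crossing (h ` d) (h ` d')"
begin

abbreviation flip :: "nat set set \<Rightarrow> nat set set" where
  "flip D \<equiv> image h ` D"

lemma inj_on_vertices: "inj_on h (vertices n)"
  by (rule inj_on_inverseI[of _ h]) (rule involution)

lemma image_vertices: "d \<subseteq> vertices n \<Longrightarrow> h ` d \<subseteq> vertices n"
  using vertex by blast

lemma image_image_id:
  assumes "d \<subseteq> vertices n"
  shows "h ` h ` d = d"
proof -
  have "(\<lambda>v. h (h v)) ` d = id ` d"
    by (rule image_cong[OF refl]) (use assms involution in auto)
  then show ?thesis by (simp add: image_image)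
qed

lemma side_image_iff: "d \<subseteq> vertices n \<Longrightarrow> h ` d \<in> sides n \<longleftrightarrow> d \<in> sides n"
  using side[of d] side[of "h ` d"] image_image_id[of d] by auto

lemma card_image_vertices: "d \<subseteq> vertices n \<Longrightarrow> card (h ` d) = card d"
  by (rule card_image) (rule inj_on_subset[OF inj_on_vertices])

lemma diagonal_vertices: "d \<in> diagonals n \<Longrightarrow> d \<subseteq> vertices n"
  by (simp add: diagonals_def)

lemma diagonal_image: "d \<in> diagonals n \<Longrightarrow> h ` d \<in> diagonals n"
  using image_vertices[of d] card_image_vertices[of d] side_image_iff[of d]
  by (simp add: diagonals_def)

lemma flip_flip:
  assumes "D \<subseteq> diagonals n"
  shows "flip (flip D) = D"
proof -
  have "h ` h ` d = id d" if "d \<in> D" for d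
    using image_image_id diagonal_vertices assms that by auto
  then have "(\<lambda>d. h ` h ` d) ` D = id ` D"
    by (rule image_cong[OF refl])
  then show ?thesis by (simp add: image_image)
qed

lemma flip_diagonals: "D \<subseteq> diagonals n \<Longrightarrow> flip D \<subseteq> diagonals n"
  using diagonal_image by blast

lemma flip_noncrossing:
  assumes "D \<subseteq> diagonals n" "noncrossing D"
  shows "noncrossing (flip D)"
  unfolding noncrossing_def
proof (intro ballI notI)
  fix d d' assume "d \<in> flip D" "d' \<in> flip D" and cr: "crossing d d'"
  then obtain a a' where a: "a \<in> D" "d = h ` a" "a' \<in> D" "d' = h ` a'" by blast
  have sub: "a \<subseteq> vertices n" "a' \<subseteq> vertices n"
    using subsetD[OF assms(1) a(1)] subsetD[OF assms(1) a(3)] by (simp_all add: diagonal_vertices)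
  have "crossing (h ` d) (h ` d')"
    unfolding a(2,4)
    by (rule crossing_image[OF image_vertices[OF sub(1)] image_vertices[OF sub(2)] cr[unfolded a(2,4)]])
  then have "crossing a a'" using a sub by (simp add: image_image_id)
  then show False using assms(2) a unfolding noncrossing_def by blast
qed

text \<open>A noncrossing set above \<open>flip D\<close> flips back to one above \<open>D\<close>,
  so maximality is inherited.\<close>

lemma flip_triangulation:
  assumes "D \<in> triangulations n"
  shows "flip D \<in> triangulations n"
proof -
  have D: "D \<subseteq> diagonals n" and nc: "noncrossing D"
    and mx: "\<And>D'. D \<subseteq> D' \<Longrightarrow> D' \<subseteq> diagonals n \<Longrightarrow> noncrossing D' \<Longrightarrow> D' = D"
    using assms unfolding triangulations_def by auto
  have "D' = flip D" if "flip D \<subseteq> D'" "D' \<subseteq> diagonals n" "noncrossing D'" for D'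
  proof -
    have "D \<subseteq> flip D'" using image_mono[OF that(1), of "image h"] flip_flip[OF D] by simp
    then have "flip D' = D"
      by (rule mx[OF _ flip_diagonals[OF that(2)] flip_noncrossing[OF that(2,3)]])
    then show ?thesis using flip_flip[OF that(2)] by simp
  qed
  then show ?thesis
    unfolding triangulations_def using flip_diagonals[OF D] flip_noncrossing[OF D nc] by simp
qed

lemma triangle_image:
  assumes D: "D \<subseteq> diagonals n" and T: "T \<in> triangles n D"
  shows "h ` T \<in> triangles n (flip D)"
proof -
  have sub: "T \<subseteq> vertices n" and "card T = 3"
    and E: "\<And>x y. x \<in> T \<Longrightarrow> y \<in> T \<Longrightarrow> x \<noteq> y \<Longrightarrow> {x, y} \<in> sides n \<union> D"
    using T unfolding triangles_def by auto
  have "{h x, h y} \<in> sides n \<union> flip D" if "x \<in> T" "y \<in> T" "h x \<noteq> h y" for x y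
  proof -
    have "{x, y} \<in> sides n \<union> D" using E that by blast
    then have "h ` {x, y} \<in> sides n \<union> flip D" using side by blast
    then show ?thesis by simp
  qed
  then show ?thesis
    unfolding triangles_def using image_vertices[OF sub] card_image_vertices[OF sub] \<open>card T = 3\<close> by auto
qed

definition flip_colouring :: "(nat \<Rightarrow> colour) \<Rightarrow> nat \<Rightarrow> colour" where
  "flip_colouring c = restrict (\<lambda>v. c (h v)) (vertices n)"

lemma flip_colouring_flip_colouring:
  "c \<in> extensional (vertices n) \<Longrightarrow> flip_colouring (flip_colouring c) = c"
  by (rule extensionalityI[of _ "vertices n"]) (auto simp: flip_colouring_def vertex involution)

lemma is_colouring_flip:
  assumes D: "D \<subseteq> diagonals n" and se: "s \<in> vertices n" "e \<in> vertices n"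
    and c: "is_colouring n s e D c"
  shows "is_colouring n (h s) (h e) (flip D) (flip_colouring c)"
  unfolding is_colouring_def
proof (intro conjI ballI)
  show "flip_colouring c \<in> vertices n \<rightarrow>\<^sub>E UNIV" by (simp add: flip_colouring_def)
  show "flip_colouring c (h s) = Col_b" "flip_colouring c (h e) = Col_c"
    using c se by (auto simp: flip_colouring_def vertex involution is_colouring_def)
  fix T assume T: "T \<in> triangles n (flip D)"
  then have sub: "T \<subseteq> vertices n" by (simp add: triangles_def)
  have "h ` T \<in> triangles n D"
    using triangle_image[OF flip_diagonals[OF D] T] flip_flip[OF D] by simp
  then have "inj_on c (h ` T)" using c by (simp add: is_colouring_def)
  then have "inj_on (c \<circ> h) T"
    by (rule comp_inj_on[OF inj_on_subset[OF inj_on_vertices sub]])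
  moreover have "flip_colouring c v = (c \<circ> h) v" if "v \<in> T" for v
    using that sub by (auto simp: flip_colouring_def)
  ultimately show "inj_on (flip_colouring c) T" by (simp cong: inj_on_cong)
qed

lemma num_coloured_flip: "num_coloured n (flip_colouring c) w = num_coloured n c w"
proof -
  have "{v \<in> vertices n. c v = w} = h ` {v \<in> vertices n. flip_colouring c v = w}"
  proof (intro equalityI subsetI)
    fix v assume "v \<in> {v \<in> vertices n. c v = w}"
    then have "v = h (h v)" "h v \<in> {v \<in> vertices n. flip_colouring c v = w}"
      by (auto simp: flip_colouring_def vertex involution)
    then show "v \<in> h ` {v \<in> vertices n. flip_colouring c v = w}" by (rule image_eqI)
  qed (auto simp: flip_colouring_def vertex)
  then show ?thesis
    unfolding num_coloured_def by (simp add: card_image_vertices)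
qed

text \<open>Composing with \<open>h\<close> matches the colourings of \<open>D\<close> for (s, e)
  with those of \<open>flip D\<close> for (h s, h e) and preserves colour counts; flipping then
  matches the triangulations counted.\<close>

lemma correct_root_flip:
  assumes se: "s \<in> vertices n" "e \<in> vertices n" and cr: "correct_root n f K (h s) (h e)"
  shows "correct_root n f K s e"
proof -
  have ex1: "\<exists>!c. is_colouring n (h s) (h e) (flip D) c" if "D \<in> triangulations n" for D
    using cr flip_triangulation[OF that] unfolding correct_root_def by blast
  have ext: "c \<in> extensional (vertices n)" if "is_colouring n s e D c" for s e D c
    using that by (simp add: is_colouring_def PiE_def)
  have unflip: "is_colouring n s e D (flip_colouring c)"
    if D: "D \<in> triangulations n" and c: "is_colouring n (h s) (h e) (flip D) c" for D c
    using is_colouring_flip[OF flip_diagonals[OF triangulations_subset[OF D]] _ _ c] se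
      flip_flip[OF triangulations_subset[OF D]]
    by (simp add: vertex involution)
  have ex1': "\<exists>!c. is_colouring n s e D c" if D: "D \<in> triangulations n" for D
  proof -
    obtain c where c: "is_colouring n (h s) (h e) (flip D) c" using ex1[OF D] by blast
    show ?thesis
    proof (rule ex1I)
      show "is_colouring n s e D (flip_colouring c)" by (rule unflip[OF D c])
      fix c' assume c': "is_colouring n s e D c'"
      have "flip_colouring c' = c"
        using is_colouring_flip[OF triangulations_subset[OF D] se c'] c ex1[OF D] by blast
      then show "c' = flip_colouring c"
        using flip_colouring_flip_colouring[OF ext[OF c']] by simp
    qed
  qed
  have num: "num_coloured n (colouring n s e D) w = num_coloured n (colouring n (h s) (h e) (flip D)) w"
    if D: "D \<in> triangulations n" for D w
  proof -
    have "is_colouring n s e D (colouring n s e D)"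
      unfolding colouring_def by (rule theI'[OF ex1'[OF D]])
    then have "is_colouring n (h s) (h e) (flip D) (flip_colouring (colouring n s e D))"
      by (rule is_colouring_flip[OF triangulations_subset[OF D] se])
    then have "colouring n (h s) (h e) (flip D) = flip_colouring (colouring n s e D)"
      unfolding colouring_def by (rule the1_equality[OF ex1[OF D]])
    then show ?thesis by (simp add: num_coloured_flip)
  qed
  let ?A = "{D \<in> triangulations n. \<forall>w. num_coloured n (colouring n s e D) w = f w}"
  let ?B = "{D \<in> triangulations n. \<forall>w. num_coloured n (colouring n (h s) (h e) D) w = f w}"
  have "bij_betw flip ?A ?B"
  proof (rule bij_betwI[where g = flip])
    show "flip \<in> ?A \<rightarrow> ?B"
    proof
      fix D assume "D \<in> ?A"
      then show "flip D \<in> ?B" using flip_triangulation[of D] num[of D] by simp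
    qed
    show "flip \<in> ?B \<rightarrow> ?A"
    proof
      fix D assume D: "D \<in> ?B"
      then have "D \<in> triangulations n" by simp
      then show "flip D \<in> ?A"
        using D flip_triangulation[of D] num[of "flip D"] flip_flip[OF triangulations_subset[of D]] by simp
    qed
    show "flip (flip D) = D" if "D \<in> ?A" for D
      by (rule flip_flip) (use that triangulations_subset in blast)
    show "flip (flip D) = D" if "D \<in> ?B" for D
      by (rule flip_flip) (use that triangulations_subset in blast)
  qed
  then have "card ?A = card ?B" by (rule bij_betw_same_card)
  then show ?thesis using cr ex1' unfolding correct_root_def by simp
qed

end

text \<open>\<open>i \<mapsto> k - i\<close> modulo \<open>n + 2\<close>. Reflections are preferred to rotations because they are
  involutions, so that every invariance needs to be shown in one direction only.\<close>

definition reflection :: "nat \<Rightarrow> nat \<Rightarrow> nat \<Rightarrow> nat" where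
  "reflection n k i = (if i \<le> k then k - i else k + (n + 2) - i)"

lemma crossingI:
  assumes "a < b" "b < c" "c < d"
  shows "crossing {a, c} {b, d}" "crossing {c, a} {b, d}" "crossing {a, c} {d, b}" "crossing {c, a} {d, b}"
    "crossing {b, d} {a, c}" "crossing {d, b} {a, c}" "crossing {b, d} {c, a}" "crossing {d, b} {c, a}"
proof -
  have eqs: "{c, a} = {a, c}" "{d, b} = {b, d}" by auto
  have "crossing {a, c} {b, d}" "crossing {b, d} {a, c}"
    unfolding crossing_def using assms by blast+
  then show "crossing {a, c} {b, d}" "crossing {c, a} {b, d}" "crossing {a, c} {d, b}" "crossing {c, a} {d, b}"
    "crossing {b, d} {a, c}" "crossing {d, b} {a, c}" "crossing {b, d} {c, a}" "crossing {d, b} {c, a}"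
    unfolding eqs by simp_all
qed

text \<open>Each of the blocks 0..k and k+1..n+1 is mapped to itself in reverse order, so
  comparisons between the blocks are kept.\<close>

lemma reflection_less:
  assumes "i < j"
  shows "j \<le> k \<Longrightarrow> reflection n k j < reflection n k i"
    and "k < i \<Longrightarrow> j < n + 2 \<Longrightarrow> reflection n k j < reflection n k i"
    and "i \<le> k \<Longrightarrow> k < j \<Longrightarrow> j < n + 2 \<Longrightarrow> reflection n k i < reflection n k j"
  using assms by (simp_all add: reflection_def)

lemma reflection_crossing:
  assumes "i < j" "j < l" "l < m" "m < n + 2"
  shows "crossing (reflection n k ` {i, l}) (reflection n k ` {j, m})"
proof -
  let ?r = "reflection n k"
  \<comment> \<open>The cases record how many of the four vertices lie in the first block; in each,
    the images are again in cyclic order, reversed.\<close>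
  consider "m \<le> k" | "l \<le> k" "k < m" | "j \<le> k" "k < l" | "i \<le> k" "k < j" | "k < i"
    using assms by linarith
  then have "crossing {?r i, ?r l} {?r j, ?r m}"
  proof cases
    case 1
    with assms have "?r m < ?r l" "?r l < ?r j" "?r j < ?r i" by (auto intro: reflection_less(1))
    then show ?thesis by (rule crossingI)
  next
    case 2
    with assms have "?r l < ?r j" "?r j < ?r i" "?r i < ?r m" by (auto intro: reflection_less(1,3))
    then show ?thesis by (rule crossingI)
  next
    case 3
    with assms have "?r j < ?r i" "?r i < ?r m" "?r m < ?r l" by (auto intro: reflection_less)
    then show ?thesis by (rule crossingI)
  next
    case 4
    with assms have "?r i < ?r m" "?r m < ?r l" "?r l < ?r j" by (auto intro: reflection_less(2,3))
    then show ?thesis by (rule crossingI)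
  next
    case 5
    with assms have "?r m < ?r l" "?r l < ?r j" "?r j < ?r i" by (auto intro: reflection_less(2))
    then show ?thesis by (rule crossingI)
  qed
  then show ?thesis by simp
qed

lemma polygon_symmetry_reflection:
  assumes k: "k < n + 2"
  shows "polygon_symmetry n (reflection n k)"
proof
  let ?r = "reflection n k"
  show v: "?r v \<in> vertices n" if "v \<in> vertices n" for v
    using that k by (auto simp: vertices_def reflection_def)
  show "?r (?r v) = v" if "v \<in> vertices n" for v
    using that k by (auto simp: vertices_def reflection_def)
  show "?r ` d \<in> sides n" if d: "d \<in> sides n" for d
  proof -
    obtain v where vd: "v < n + 2" "d = {v, Suc v mod (n + 2)}"
      using d by (auto simp: sides_def vertices_def)
    \<comment> \<open>A reflection reverses orientation, so the image of a side starts at the image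
      of its end point.\<close>
    define u where "u = ?r (Suc v mod (n + 2))"
    have "u < n + 2" using v[of "Suc v mod (n + 2)"] by (simp add: u_def vertices_def)
    moreover have "?r v = Suc u mod (n + 2)"
    proof -
      have wrap: "Suc w mod (n + 2) = (if w = n + 1 then 0 else Suc w)" if "w < n + 2" for w
        using that by auto
      show ?thesis
        unfolding wrap[OF \<open>u < n + 2\<close>] unfolding u_def wrap[OF vd(1)]
        using vd(1) k by (auto simp: reflection_def)
    qed
    ultimately show ?thesis
      unfolding vd(2) sides_def u_def vertices_def by (auto simp: insert_commute)
  qed
  show "crossing (?r ` d) (?r ` d')"
    if sub: "d \<subseteq> vertices n" "d' \<subseteq> vertices n" and cr: "crossing d d'" for d d'
  proof -
    obtain i j l m where lt: "i < j" "j < l" "l < m"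
      and dd: "d = {i, l} \<and> d' = {j, m} \<or> d = {j, m} \<and> d' = {i, l}"
      using cr unfolding crossing_def by blast
    have "m < n + 2" using dd sub by (auto simp: vertices_def)
    from reflection_crossing[OF lt this] show ?thesis using dd crossing_sym by blast
  qed
qed

text \<open>\<open>reflection n s\<close> sends \<open>s\<close> to 0 and \<open>e\<close> to a
  neighbour of 0, namely 1 or n + 1 depending on the orientation; \<open>reflection n 0\<close>
  fixes 0 and exchanges these two.\<close>

lemma correct_root_any:
  assumes root: "s \<in> vertices n" "e \<in> vertices n" "{s, e} \<in> sides n" "s \<noteq> e"
    and base: "correct_root n f K 0 (n + 1)"
  shows "correct_root n f K s e"
proof -
  have V: "0 \<in> vertices n" "1 \<in> vertices n" by (auto simp: vertices_def)
  interpret r0: polygon_symmetry n "reflection n 0" by (rule polygon_symmetry_reflection) simp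
  have r0: "reflection n 0 0 = 0" "reflection n 0 1 = n + 1" by (auto simp: reflection_def)
  have one: "correct_root n f K 0 1"
    by (rule r0.correct_root_flip[OF V]) (simp only: r0 base)
  have s: "s < n + 2" using root(1) by (simp add: vertices_def)
  interpret rs: polygon_symmetry n "reflection n s" by (rule polygon_symmetry_reflection[OF s])
  have "e = Suc s \<or> s = Suc e \<or> s = 0 \<and> e = n + 1 \<or> e = 0 \<and> s = n + 1"
    using root(3,4) side_iff[of s e n] side_iff[of e s n]
    by (cases "s < e") (auto simp: insert_commute)
  then have "reflection n s s = 0" "reflection n s e = 1 \<or> reflection n s e = n + 1"
    using s by (auto simp: reflection_def)
  then have "correct_root n f K (reflection n s s) (reflection n s e)" using base one by auto
  then show ?thesis by (rule rs.correct_root_flip[OF root(1,2)])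
qed

section \<open>The count\<close>

lemma length_eq_colour_counts:
  "length xs = count_list xs Col_a + count_list xs Col_b + count_list xs Col_c"
proof (induction xs)
  case (Cons x xs)
  then show ?case by (cases x) auto
qed simp

lemma all_colours: "(\<forall>w. P w) \<longleftrightarrow> P Col_a \<and> P Col_b \<and> P Col_c"
  by (metis colour.exhaust)

text \<open>The ends of the root edge supply one b and one c, so the inner vertices have colour
  counts i, j, k and form a one-tree forest.\<close>

lemma card_boundary_colours:
  assumes "i + j + k = n"
  shows "real (card {t. leaves t = n + 1 \<and> count_list (boundary_colours t) Col_a = i \<and>
      count_list (boundary_colours t) Col_b = Suc j \<and> count_list (boundary_colours t) Col_c = Suc k})
    = good_coeff (Suc (j + k)) (i + k) (i + j) i j k" (is "real (card ?S) = _")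
proof -
  define f where "f = case_colour i j k"
  have "(\<lambda>t. [t]) ` ?S = forests [(Col_b, Col_c)] f"
  proof (intro equalityI subsetI)
    fix ts assume "ts \<in> forests [(Col_b, Col_c)] f"
    then have len: "length ts = 1" and cnt: "\<And>w. count_list (forest_colours [(Col_b, Col_c)] ts) w = f w"
      by (auto simp: forests_def)
    from len obtain t where t: "ts = [t]" by (cases ts) auto
    have c: "count_list (inner_colours Col_b Col_c t) w = f w" for w
      using cnt[of w] t by simp
    \<comment> \<open>Forests do not prescribe the number of leaves; it follows from the number i +
      j + k of inner vertices.\<close>
    have "leaves t = n + 1"
      using length_eq_colour_counts[of "inner_colours Col_b Col_c t"] assms leaves_pos[of t]
      unfolding c length_inner_colours by (simp add: f_def del: leaves_pos)
    then have "t \<in> ?S" using c by (simp add: boundary_colours_def f_def)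
    then show "ts \<in> (\<lambda>t. [t]) ` ?S" using t by blast
  qed (auto simp: forests_def all_colours boundary_colours_def f_def)
  moreover have "card ((\<lambda>t. [t]) ` ?S) = card ?S" by (rule card_image) (simp add: inj_on_def)
  ultimately have "real (card ?S) = forest_number [(Col_b, Col_c)] f"
    using card_forests[of "[(Col_b, Col_c)]" f] by simp
  then show ?thesis by (simp add: forest_number_def root_count_def third_def f_def)
qed

theorem theorem1:
  fixes n \<alpha> \<beta> \<gamma> s e :: nat
  assumes sum: "\<alpha> + \<beta> + \<gamma> = n + 2"
    and root: "s \<in> vertices n" "e \<in> vertices n" "{s, e} \<in> sides n" "s \<noteq> e"
  shows "real (card {D \<in> triangulations n.
             num_coloured n (colouring n s e D) Col_a = \<alpha> \<and>
             num_coloured n (colouring n s e D) Col_b = \<beta> \<and>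
             num_coloured n (colouring n s e D) Col_c = \<gamma>}) =
         (if \<alpha> = 0 then (if \<beta> = 1 \<and> \<gamma> = 1 then 1 else 0)
          else (real \<alpha> * (real \<alpha> + real \<beta> + real \<gamma> - 2)) /
               ((real \<beta> + real \<gamma> - 1) * (real \<alpha> + real \<gamma> - 1) * (real \<alpha> + real \<beta> - 1)) *
               binom (int \<beta> + int \<gamma> - 1) (int \<alpha>) *
               binom (int \<alpha> + int \<gamma> - 1) (int \<beta> - 1) *
               binom (int \<alpha> + int \<beta> - 1) (int \<gamma> - 1))" (is "?L = ?R")
proof -
  let ?S = "{t. leaves t = n + 1 \<and> count_list (boundary_colours t) Col_a = \<alpha> \<and>
    count_list (boundary_colours t) Col_b = \<beta> \<and> count_list (boundary_colours t) Col_c = \<gamma>}"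
  define f where "f = case_colour \<alpha> \<beta> \<gamma>"
  have "correct_root n f
      (real (card {t. leaves t = n + 1 \<and> (\<forall>w. count_list (boundary_colours t) w = f w)})) s e"
    by (rule correct_root_any[OF root correct_root_0])
  then have L: "?L = real (card ?S)"
    unfolding correct_root_def all_colours by (simp add: f_def)
  show ?thesis
  proof (cases "\<beta> = 0 \<or> \<gamma> = 0")
    \<comment> \<open>No colouring misses b or c. On the right a lower index -1 makes a binomial
      factor 0, whatever the value of the quotient.\<close>
    case True
    then have S: "?S = {}" by (auto simp: boundary_colours_def)
    have R: "?R = 0" using True by (auto simp: binom_def)
    show ?thesis unfolding L S R by simp
  next
    case False
    then obtain j k where jk: "\<beta> = Suc j" "\<gamma> = Suc k" by (metis not0_implies_Suc)
    have "?L = good_coeff (Suc (j + k)) (\<alpha> + k) (\<alpha> + j) \<alpha> j k"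
      unfolding L unfolding jk by (rule card_boundary_colours) (use sum jk in simp)
    \<comment> \<open>With \<beta> = j + 1 and \<gamma> = k + 1 the upper entries of the three
      binomials are the exponents j + k + 1, \<alpha> + k and \<alpha> + j.\<close>
    also have "\<dots> = ?R"
      unfolding good_coeff_closed_form by (simp add: jk binom_def add_ac)
    finally show ?thesis .
  qed
qed

end
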